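(* Let $r\ge2$ and $N\ge1$ be integers and suppose there exists an $r$-coloring of $\mathbb{Z}/N\mathbb{Z}$ with no symmetrically colored 4-AP. Then there is a constant $C$ (depending on $r,N$) such that for all $0<\alpha<1$, $\widetilde\rho_4(\alpha)\le C\alpha^{3+\frac12\log_rN}$.
   Context: In $\mathbb{Z}/N\mathbb{Z}$, a 4-AP $n,n+d,n+2d,n+3d$ with $d\ne0$ is symmetrically colored if $n,n+3d$ have the same color and $n+d,n+2d$ have the same color. $\mathbb{T}=\mathbb{R}/\mathbb{Z}$. $F\colon\mathbb{T}^2\to[0,1]$ has constant first marginal $\alpha$ if $\int_\mathbb{T}F(x,y)\,dy=\alpha$ for a.e. $x$. $\widetilde\Lambda_4(F)=\mathbb{E}_{(x,y)\in V}\prod_{i=1}^4F(x_i,y_i)$ (Haar measure on $V$), where $V\subset\mathbb{T}^8$ consists of $(x_1,\dots,x_4,y_1,\dots,y_4)$ with $x_2-x_1=x_3-x_2=x_4-x_3$ and $y_1-3y_2+3y_3-y_4=0$. $\widetilde\rho_4(\alpha)$ is the infimum of $\widetilde\Lambda_4(F)$ over Riemann integrable $F\colon\mathbb{T}^2\to[0,1]$ with constant first marginal $\alpha$. *)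

theory Defs
  imports "HOL-Analysis.Analysis"
begin

definition mod1_eq :: "real \<Rightarrow> real \<Rightarrow> bool" where
  "mod1_eq x y \<longleftrightarrow> x - y \<in> \<int>"

text \<open>The type \<open>circle\<close> is the group \<open>\<real>/\<int>\<close> with the quotient topology;
  \<open>abs_circle\<close> is the projection from the reals.\<close>

quotient_type circle = real / mod1_eq
proof (rule equivpI)
  show "reflp mod1_eq"
    by (simp add: reflp_def mod1_eq_def)
  show "symp mod1_eq"
    unfolding symp_def mod1_eq_def by (metis Ints_minus minus_diff_eq)
  show "transp mod1_eq"
    unfolding transp_def mod1_eq_def
    by (metis Ints_add add_diff_eq diff_add_cancel)
qed

instantiation circle :: ab_group_add
begin

lift_definition zero_circle :: circle is "0::real" .

lift_definition plus_circle :: "circle \<Rightarrow> circle \<Rightarrow> circle" is "(+)"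
  unfolding mod1_eq_def by (metis Ints_add add_diff_add)

lift_definition uminus_circle :: "circle \<Rightarrow> circle" is "uminus"
  unfolding mod1_eq_def by (metis Ints_minus minus_diff_eq minus_diff_minus)

lift_definition minus_circle :: "circle \<Rightarrow> circle \<Rightarrow> circle" is "(-)"
  unfolding mod1_eq_def by (metis Ints_diff diff_diff_eq2 diff_diff_eq add_diff_eq diff_add_eq add.commute)

instance
  by standard (transfer; simp add: mod1_eq_def)+

end

instantiation circle :: topological_space
begin

definition open_circle :: "circle set \<Rightarrow> bool" where
  "open_circle U \<longleftrightarrow> open (abs_circle -` U)"

instance
proof
  show "open (UNIV :: circle set)"
    by (simp add: open_circle_def)
next
  fix S T :: "circle set"
  assume "open S" "open T"
  then show "open (S \<inter> T)"
    by (simp add: open_circle_def vimage_Int open_Int)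
next
  fix K :: "circle set set"
  assume "\<forall>S\<in>K. open S"
  then show "open (\<Union>K)"
    by (auto simp: open_circle_def vimage_Union intro!: open_UN)
qed

end

text \<open>For a closed subgroup \<open>V\<close> of a compact metrizable abelian group there is exactly one
  translation-invariant Borel probability measure on \<open>V\<close>.\<close>

definition is_haar_prob :: "'a::{topological_space, ab_group_add} set \<Rightarrow> 'a measure \<Rightarrow> bool" where
  "is_haar_prob V \<mu> \<longleftrightarrow>
     emeasure \<mu> V = 1 \<and> sets \<mu> = sets (restrict_space borel V) \<and>
     (\<forall>v\<in>V. distr \<mu> \<mu> (\<lambda>w. v + w) = \<mu>)"

definition haar_prob :: "'a::{topological_space, ab_group_add} set \<Rightarrow> 'a measure" where
  "haar_prob V = (THE \<mu>. is_haar_prob V \<mu>)"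

text \<open>This is the definition of the Henstock--Kurzweil integral in the library, with the gauges
  restricted to balls of constant radius.\<close>

definition riemann_integrable_on_cbox ::
  "('a::euclidean_space \<Rightarrow> real) \<Rightarrow> 'a \<Rightarrow> 'a \<Rightarrow> bool" where
  "riemann_integrable_on_cbox f a b \<longleftrightarrow>
     (\<exists>I. \<forall>e>0. \<exists>\<delta>>0. \<forall>D. D tagged_division_of cbox a b \<and> (\<lambda>x. ball x \<delta>) fine D \<longrightarrow>
        \<bar>(\<Sum>(x, K)\<in>D. measure lborel K * f x) - I\<bar> < e)"

definition torus_riemann_integrable :: "(circle \<times> circle \<Rightarrow> real) \<Rightarrow> bool" where
  "torus_riemann_integrable F \<longleftrightarrow>
     riemann_integrable_on_cbox (\<lambda>(s, t). F (abs_circle s, abs_circle t)) (0, 0) (1, 1)"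

definition constant_first_marginal :: "(circle \<times> circle \<Rightarrow> real) \<Rightarrow> real \<Rightarrow> bool" where
  "constant_first_marginal F \<alpha> \<longleftrightarrow>
     (AE s in lebesgue_on {0..1}.
        ((\<lambda>t. F (abs_circle s, abs_circle t)) has_integral \<alpha>) {0..1})"

text \<open>The four indices are the elements \<open>1, 2, 3, 4\<close> of the numeral type \<open>4\<close> (in which
  \<open>4 = 0\<close>). Multiplication by 3 is written as a repeated sum, since the circle is not a ring.\<close>

definition V4 :: "((circle ^ 4) \<times> (circle ^ 4)) set" where
  "V4 = {(x, y). x $ 2 - x $ 1 = x $ 3 - x $ 2 \<and> x $ 3 - x $ 2 = x $ 4 - x $ 3 \<and>
                 y $ 1 - (y $ 2 + y $ 2 + y $ 2) + (y $ 3 + y $ 3 + y $ 3) - y $ 4 = 0}"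

text \<open>The completion is needed because a Riemann integrable function need not be Borel
  measurable.\<close>

definition Lambda4 :: "(circle \<times> circle \<Rightarrow> real) \<Rightarrow> real" where
  "Lambda4 F = (\<integral>(x, y). (\<Prod>i\<in>UNIV. F (x $ i, y $ i)) \<partial>completion (haar_prob V4))"

definition rho4 :: "real \<Rightarrow> real" where
  "rho4 \<alpha> = Inf {Lambda4 F | F. range F \<subseteq> {0..1} \<and> torus_riemann_integrable F \<and>
                                constant_first_marginal F \<alpha>}"

text \<open>Residues modulo \<open>N\<close> are represented by \<open>0, \<dots>, N - 1\<close>.\<close>

definition symmetrically_colored :: "nat \<Rightarrow> (nat \<Rightarrow> nat) \<Rightarrow> nat \<Rightarrow> nat \<Rightarrow> bool" where
  "symmetrically_colored N c n d \<longleftrightarrow>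
     c (n mod N) = c ((n + 3 * d) mod N) \<and>
     c ((n + d) mod N) = c ((n + 2 * d) mod N)"

definition coloring_without_symmetric_4AP :: "nat \<Rightarrow> nat \<Rightarrow> (nat \<Rightarrow> nat) \<Rightarrow> bool" where
  "coloring_without_symmetric_4AP r N c \<longleftrightarrow>
     c ` {0..<N} \<subseteq> {0..<r} \<and>
     (\<forall>n\<in>{0..<N}. \<forall>d\<in>{0..<N}. d \<noteq> 0 \<longrightarrow> \<not> symmetrically_colored N c n d)"

end

theory Submission
  imports Defs "HOL-Probability.Probability_Measure"
begin

text \<open>
  Splitting base-\<open>N\<close> digits turns the coloring into an \<open>r ^ k\<close>-coloring of \<open>\<int>/N ^ k\<close> without
  symmetrically colored 4-APs: a symmetric progression has lowest digits in a symmetric progression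
  modulo \<open>N\<close>, so its difference is divisible by \<open>N\<close>, and one passes to the next digit. Cut the
  circle into \<open>3 * N ^ k\<close> arcs and color an arc by the color of its block of three together
  with its position in the block; the position controls the rounding errors, so a 4-AP in the
  circle whose arcs are symmetrically colored has its difference in an arc of length \<open>O(N ^ -k)\<close>
  around \<open>0\<close>.

  Let \<open>F\<close> be the indicator of the set of \<open>(x, y)\<close> with \<open>y\<close> in an interval of length \<open>\<alpha>\<close> whose left
  end depends only on the color of \<open>x\<close>. About \<open>\<alpha> ^ (-1/2)\<close> colors can be placed such that
  \<open>y\<^sub>1 + 3 y\<^sub>3 = y\<^sub>4 + 3 y\<^sub>2\<close> forces the color equalities \<open>1 = 4\<close> and \<open>2 = 3\<close>: the left ends
  are proportional to integers with base-9 digits in \<open>{0, 1, 2}\<close>. Then only the small differences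
  contribute to \<open>\<Lambda>\<^sub>4\<close>, each of them at most \<open>\<alpha> ^ 3\<close>, and \<open>r ^ (2 * k)\<close> is of the order of
  \<open>1 / \<alpha>\<close>.
\<close>

section \<open>The circle as a topological group\<close>

text \<open>Makes the Haar lemmas below applicable to products of circles, in which the parameters
  of \<open>V4\<close> live.\<close>

instance prod :: (topological_monoid_add, topological_monoid_add) topological_monoid_add
proof
  fix a b :: "'a \<times> 'b"
  have "((\<lambda>x. (fst (fst x) + fst (snd x), snd (fst x) + snd (snd x)))
      \<longlongrightarrow> (fst a + fst b, snd a + snd b)) (nhds (a, b))"
  proof -
    have "((\<lambda>x. x) \<longlongrightarrow> (a, b)) (nhds (a, b))" by (simp add: filterlim_ident)
    from tendsto_fst[OF this] tendsto_snd[OF this]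
    have "(fst \<longlongrightarrow> a) (nhds (a, b))" "(snd \<longlongrightarrow> b) (nhds (a, b))" by simp_all
    then show ?thesis
      by (intro tendsto_Pair tendsto_add tendsto_fst tendsto_snd)
  qed
  then show "LIM x nhds a \<times>\<^sub>F nhds b. fst x + snd x :> nhds (a + b)"
    by (simp add: plus_prod_def nhds_prod)
qed

lemma abs_circle_eq_iff: "abs_circle s = abs_circle t \<longleftrightarrow> s - t \<in> \<int>"
  by (metis circle.abs_eq_iff mod1_eq_def)

lemma continuous_on_abs_circle [continuous_intros]:
  "continuous_on S f \<Longrightarrow> continuous_on S (\<lambda>x. abs_circle (f x))"
proof -
  have "continuous_on UNIV abs_circle"
    by (simp add: continuous_on_open_vimage open_circle_def)
  then show "continuous_on S f \<Longrightarrow> continuous_on S (\<lambda>x. abs_circle (f x))"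
    using continuous_on_compose2 by blast
qed

text \<open>The preimage of the image is the union of the integer translates of
  \<open>U\<close>.\<close>

lemma open_image_abs_circle:
  assumes "open U"
  shows "open (abs_circle ` U)"
proof -
  have "abs_circle -` abs_circle ` U = (\<Union>n::int. (+) (of_int n) ` U)"
  proof (intro set_eqI iffI)
    fix s assume "s \<in> abs_circle -` abs_circle ` U"
    then obtain t where t: "abs_circle s = abs_circle t" "t \<in> U" by auto
    then obtain n where "s - t = of_int n" by (auto simp: abs_circle_eq_iff elim: Ints_cases)
    then have "s = of_int n + t" by simp
    with t show "s \<in> (\<Union>n::int. (+) (of_int n) ` U)" by blast
  next
    fix s assume "s \<in> (\<Union>n::int. (+) (of_int n) ` U)"
    then obtain n :: int and t where t: "t \<in> U" "s = of_int n + t" by auto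
    then have "abs_circle s = abs_circle t" by (simp add: abs_circle_eq_iff)
    with t show "s \<in> abs_circle -` abs_circle ` U" by auto
  qed
  then show ?thesis
    using assms by (simp add: open_circle_def open_UN open_translation)
qed

lemma abs_circle_surj: "\<exists>s. x = abs_circle s"
  by (metis Quotient3_abs_rep Quotient3_circle)

text \<open>Joint continuity of addition descends from the reals because \<open>abs_circle\<close>
  is open: small real neighbourhoods of \<open>s\<close> and \<open>t\<close> have open images,
  whose product is the required neighbourhood of \<open>(a, b)\<close>.\<close>

instance circle :: topological_group_add
proof
  fix a b :: circle
  obtain s t where st: "a = abs_circle s" "b = abs_circle t"
    using abs_circle_surj by metis
  show "LIM x nhds a \<times>\<^sub>F nhds b. fst x + snd x :> nhds (a + b)"
    unfolding nhds_prod[symmetric]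
  proof (rule topological_tendstoI)
    fix W assume "open W" "a + b \<in> W"
    then have "open (abs_circle -` W)" "s + t \<in> abs_circle -` W"
      by (simp_all add: open_circle_def st plus_circle.abs_eq)
    moreover have "((\<lambda>x. fst x + snd x) \<longlongrightarrow> s + t) (nhds (s, t))"
      unfolding nhds_prod by (rule tendsto_add_Pair)
    ultimately have "\<forall>\<^sub>F x in nhds (s, t). fst x + snd x \<in> abs_circle -` W"
      using topological_tendstoD by blast
    then obtain X where X: "open X" "(s, t) \<in> X" "\<forall>x\<in>X. fst x + snd x \<in> abs_circle -` W"
      unfolding eventually_nhds by blast
    then obtain U V where UV: "open U" "open V" "s \<in> U" "t \<in> V" "U \<times> V \<subseteq> X"
      by (metis mem_Sigma_iff open_prod_elim)
    have "\<forall>p \<in> abs_circle ` U \<times> abs_circle ` V. fst p + snd p \<in> W"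
    proof
      fix p assume "p \<in> abs_circle ` U \<times> abs_circle ` V"
      then obtain u v where uv: "u \<in> U" "v \<in> V" "p = (abs_circle u, abs_circle v)" by blast
      then have "u + v \<in> abs_circle -` W" using X(3) UV(5) by force
      then show "fst p + snd p \<in> W" by (simp add: uv plus_circle.abs_eq)
    qed
    moreover have "open (abs_circle ` U \<times> abs_circle ` V)" "(a, b) \<in> abs_circle ` U \<times> abs_circle ` V"
      using UV by (auto simp: st open_image_abs_circle open_Times)
    ultimately show "\<forall>\<^sub>F x in nhds (a, b). fst x + snd x \<in> W"
      unfolding eventually_nhds by blast
  qed
  show "(uminus \<longlongrightarrow> - a) (nhds a)"
  proof (rule topological_tendstoI)
    fix W assume W: "open W" "- a \<in> W"
    have "abs_circle -` uminus -` W = uminus ` (abs_circle -` W)"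
    proof safe
      fix u assume "- abs_circle u \<in> W"
      then have "- u \<in> abs_circle -` W" by (simp add: uminus_circle.abs_eq)
      then show "u \<in> uminus ` (abs_circle -` W)" by (metis image_eqI minus_minus)
    qed (simp add: uminus_circle.abs_eq)
    then have "open (uminus -` W)"
      using W(1) by (simp add: open_circle_def open_negations)
    then show "\<forall>\<^sub>F x in nhds a. - x \<in> W"
      using W(2) unfolding eventually_nhds by blast
  qed
qed

text \<open>An open surjection maps a basis to a basis. Second countability makes the Borel sets of
  a product agree with the product of the Borel sets, as Fubini arguments require.\<close>

instance circle :: second_countable_topology
proof
  obtain B :: "real set set" where B: "countable B" "topological_basis B"
    using ex_countable_basis by blast
  have "topological_basis ((`) abs_circle ` B)"
  proof (rule topological_basisI)
    show "open X" if "X \<in> (`) abs_circle ` B" for X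
      using that B(2) open_image_abs_circle topological_basis_open by blast
    fix X :: "circle set" and x assume X: "open X" "x \<in> X"
    obtain s where s: "x = abs_circle s" using abs_circle_surj by metis
    obtain U where "U \<in> B" "s \<in> U" "U \<subseteq> abs_circle -` X"
      using topological_basisE[OF B(2), of "abs_circle -` X" s] X by (auto simp: open_circle_def s)
    then show "\<exists>Y\<in>(`) abs_circle ` B. x \<in> Y \<and> Y \<subseteq> X" by (auto simp: s)
  qed
  moreover have "countable ((`) abs_circle ` B)" using B(1) by simp
  ultimately show "\<exists>B :: circle set set. countable B \<and> open = generate_topology B"
    using topological_basis_imp_subbasis by blast
qed

section \<open>Haar measures\<close>

text \<open>Integrate \<open>indicator A (v + w)\<close> over \<mu> and \<nu>. By invariance the
  inner integral is the constant \<mu>(A) in one order and \<nu>(A) in the other, and Fubini equates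
  the two.\<close>

lemma is_haar_prob_unique:
  fixes \<mu> \<nu> :: "'a :: {second_countable_topology, topological_monoid_add, ab_group_add} measure"
  assumes \<mu>: "is_haar_prob UNIV \<mu>" and \<nu>: "is_haar_prob UNIV \<nu>"
  shows "\<mu> = \<nu>"
proof (rule measure_eqI)
  have sets [measurable_cong]: "sets \<mu> = sets borel" "sets \<nu> = sets borel"
    using \<mu> \<nu> by (simp_all add: is_haar_prob_def)
  then show "sets \<mu> = sets \<nu>" by simp
  have space [simp]: "space \<mu> = UNIV" "space \<nu> = UNIV"
    using sets by (auto dest: sets_eq_imp_space_eq)
  interpret M: prob_space \<mu> using \<mu> by (auto intro!: prob_spaceI simp: is_haar_prob_def)
  interpret N: prob_space \<nu> using \<nu> by (auto intro!: prob_spaceI simp: is_haar_prob_def)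
  interpret pair_sigma_finite \<mu> \<nu> ..
  have translate: "emeasure \<rho> A = (\<integral>\<^sup>+ w. indicator A (v + w) \<partial>\<rho>)"
    if "is_haar_prob UNIV \<rho>" "A \<in> sets borel" for \<rho> :: "'a measure" and A v
  proof -
    have [measurable_cong]: "sets \<rho> = sets borel" and d: "distr \<rho> \<rho> ((+) v) = \<rho>"
      using that by (simp_all add: is_haar_prob_def)
    have "emeasure \<rho> A = (\<integral>\<^sup>+ w. indicator A w \<partial>distr \<rho> \<rho> ((+) v))"
      using that by (simp add: d \<open>sets \<rho> = sets borel\<close>)
    also have "\<dots> = (\<integral>\<^sup>+ w. indicator A (v + w) \<partial>\<rho>)"
      using that by (subst nn_integral_distr) (auto simp: \<open>sets \<rho> = sets borel\<close>)
    finally show ?thesis .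
  qed
  fix A assume "A \<in> sets \<mu>"
  then have A [measurable]: "A \<in> sets borel" by (simp add: sets)
  have "emeasure \<mu> A = (\<integral>\<^sup>+ w. emeasure \<mu> A \<partial>\<nu>)"
    by (simp add: N.emeasure_space_1[simplified])
  also have "\<dots> = (\<integral>\<^sup>+ w. (\<integral>\<^sup>+ v. indicator A (v + w) \<partial>\<mu>) \<partial>\<nu>)"
    using translate[OF \<mu> A] by (simp add: add.commute)
  also have "\<dots> = (\<integral>\<^sup>+ v. (\<integral>\<^sup>+ w. indicator A (v + w) \<partial>\<nu>) \<partial>\<mu>)"
    by (rule Fubini') measurable
  also have "\<dots> = (\<integral>\<^sup>+ v. emeasure \<nu> A \<partial>\<mu>)"
    using translate[OF \<nu> A] by simp
  also have "\<dots> = emeasure \<nu> A"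
    by (simp add: M.emeasure_space_1[simplified])
  finally show "emeasure \<mu> A = emeasure \<nu> A" .
qed

lemma is_haar_prob_pair:
  fixes P :: "'a :: {second_countable_topology, topological_monoid_add, ab_group_add} measure"
    and Q :: "'b :: {second_countable_topology, topological_monoid_add, ab_group_add} measure"
  assumes P: "is_haar_prob UNIV P" and Q: "is_haar_prob UNIV Q"
  shows "is_haar_prob UNIV (P \<Otimes>\<^sub>M Q)"
proof -
  have sets [measurable_cong]: "sets P = sets borel" "sets Q = sets borel"
    using P Q by (simp_all add: is_haar_prob_def)
  have space [simp]: "space P = UNIV" "space Q = UNIV"
    using sets by (auto dest: sets_eq_imp_space_eq)
  interpret P: prob_space P using P by (auto intro!: prob_spaceI simp: is_haar_prob_def)
  interpret Q: prob_space Q using Q by (auto intro!: prob_spaceI simp: is_haar_prob_def)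
  interpret PQ: pair_prob_space P Q ..
  have "distr (P \<Otimes>\<^sub>M Q) (P \<Otimes>\<^sub>M Q) ((+) v) = P \<Otimes>\<^sub>M Q" for v
  proof -
    have d: "distr P P ((+) (fst v)) = P" "distr Q Q ((+) (snd v)) = Q"
      using P Q by (simp_all add: is_haar_prob_def)
    have "distr P P ((+) (fst v)) \<Otimes>\<^sub>M distr Q Q ((+) (snd v))
        = distr (P \<Otimes>\<^sub>M Q) (P \<Otimes>\<^sub>M Q) (\<lambda>(x, y). (fst v + x, snd v + y))"
      by (rule pair_measure_distr) (simp_all add: d Q.sigma_finite_measure_axioms)
    also have "(\<lambda>(x, y). (fst v + x, snd v + y)) = (+) v"
      by (auto simp: fun_eq_iff plus_prod_def)
    finally show ?thesis by (simp add: d)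
  qed
  moreover have "sets (P \<Otimes>\<^sub>M Q) = sets borel"
    by (simp add: sets borel_prod[symmetric] cong: sets_pair_measure_cong)
  ultimately show ?thesis
    using PQ.emeasure_space_1 by (simp add: is_haar_prob_def space_pair_measure)
qed

text \<open>Evaluates the definite description in \<open>haar_prob\<close>. Here \<open>f\<close> is
  a Borel isomorphism of groups onto \<open>V\<close> with inverse \<open>g\<close>: pushing forward
  along \<open>f\<close> gives existence, and pushing any candidate back along \<open>g\<close>
  reduces uniqueness on \<open>V\<close> to uniqueness on a whole group.\<close>

lemma haar_prob_eq_distr:
  fixes P :: "'b :: {second_countable_topology, topological_monoid_add, ab_group_add} measure"
    and V :: "'a :: {topological_space, ab_group_add} set"
  assumes P: "is_haar_prob UNIV P"
    and f: "f \<in> borel \<rightarrow>\<^sub>M restrict_space borel V" and g: "g \<in> restrict_space borel V \<rightarrow>\<^sub>M borel"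
    and f_add: "\<And>u w. f (u + w) = f u + f w"
    and gf: "\<And>u. g (f u) = u" and fg: "\<And>v. v \<in> V \<Longrightarrow> f (g v) = v"
  shows "haar_prob V = distr P (restrict_space borel V) f"
  unfolding haar_prob_def
proof (rule the_equality)
  let ?R = "restrict_space borel V"
  have setsP [measurable_cong]: "sets P = sets borel" and P1: "emeasure P UNIV = 1"
    using P by (simp_all add: is_haar_prob_def)
  have spaceP [simp]: "space P = UNIV" using setsP by (auto dest: sets_eq_imp_space_eq)
  have spaceR [simp]: "space ?R = V" by (simp add: space_restrict_space)
  note [measurable] = f g
  have fV: "f u \<in> V" for u using measurable_space[OF f, of u] by simp
  \<comment> \<open>This expresses addition on \<open>V\<close> through \<open>f\<close> and
    \<open>g\<close>; closure of \<open>V\<close> under addition and measurability of its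
    translations both come from here.\<close>
  have V_add: "v + w = f (g v + g w)" if "v \<in> V" "w \<in> V" for v w
    using that by (simp add: f_add fg)
  have g_add: "g (v + w) = g v + g w" if "v \<in> V" "w \<in> V" for v w
    using V_add[OF that] gf by simp
  show "is_haar_prob V (distr P ?R f)"
    unfolding is_haar_prob_def
  proof (intro conjI ballI)
    have "f -` V = UNIV" using fV by auto
    then show "emeasure (distr P ?R f) V = 1"
      using sets.top[of ?R] by (simp add: emeasure_distr P1)
    show "sets (distr P ?R f) = sets ?R" by simp
    fix v assume v: "v \<in> V"
    have [measurable]: "(+) v \<in> ?R \<rightarrow>\<^sub>M ?R"
      by (subst measurable_cong[where g = "\<lambda>w. f (g v + g w)"]) (auto simp: V_add v)
    have "distr (distr P ?R f) (distr P ?R f) ((+) v) = distr P ?R (\<lambda>u. f (g v + u))"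
      by (subst distr_cong[OF refl sets_distr refl], subst distr_distr)
         (auto simp: comp_def f_add fg v)
    also have "\<dots> = distr (distr P P ((+) (g v))) ?R f"
      by (subst distr_distr) (auto simp: comp_def)
    also have "distr P P ((+) (g v)) = P"
      using P by (simp add: is_haar_prob_def)
    finally show "distr (distr P ?R f) (distr P ?R f) ((+) v) = distr P ?R f" .
  qed
  fix \<mu> assume \<mu>: "is_haar_prob V \<mu>"
  then have sets\<mu> [measurable_cong]: "sets \<mu> = sets ?R" and \<mu>1: "emeasure \<mu> V = 1"
    by (simp_all add: is_haar_prob_def)
  have space\<mu> [simp]: "space \<mu> = V"
    using sets_eq_imp_space_eq[OF sets\<mu>] by simp
  have "is_haar_prob UNIV (distr \<mu> borel g)"
    unfolding is_haar_prob_def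
  proof (intro conjI ballI)
    show "emeasure (distr \<mu> borel g) UNIV = 1"
      using \<mu>1 by (simp add: emeasure_distr)
    show "sets (distr \<mu> borel g) = sets (restrict_space borel UNIV)" by simp
    fix u :: 'b
    have [measurable]: "(+) (f u) \<in> \<mu> \<rightarrow>\<^sub>M \<mu>"
      by (subst measurable_cong[where g = "\<lambda>w. f (u + g w)"]) (auto simp: V_add fV gf)
    have "distr (distr \<mu> borel g) (distr \<mu> borel g) ((+) u) = distr \<mu> borel (\<lambda>w. u + g w)"
      by (subst distr_cong[OF refl sets_distr refl], subst distr_distr) (auto simp: comp_def)
    also have "\<dots> = distr \<mu> borel (\<lambda>w. g (f u + w))"
      by (rule distr_cong) (auto simp: g_add fV gf)
    also have "\<dots> = distr (distr \<mu> \<mu> ((+) (f u))) borel g"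
      by (subst distr_distr) (auto simp: comp_def)
    also have "distr \<mu> \<mu> ((+) (f u)) = \<mu>"
      using \<mu> fV by (simp add: is_haar_prob_def)
    finally show "distr (distr \<mu> borel g) (distr \<mu> borel g) ((+) u) = distr \<mu> borel g" .
  qed
  then have "distr \<mu> borel g = P"
    by (rule is_haar_prob_unique[OF _ P])
  then have "distr P ?R f = distr (distr \<mu> borel g) ?R f" by simp
  also have "\<dots> = distr \<mu> ?R (\<lambda>v. f (g v))"
    by (subst distr_distr) (auto simp: comp_def)
  also have "\<dots> = distr \<mu> \<mu> (\<lambda>v. v)"
    by (rule distr_cong) (simp_all add: fg sets\<mu>)
  also have "\<dots> = \<mu>" by (rule distr_id)
  finally show "\<mu> = distr P ?R f" by simp
qed

section \<open>Representatives in the unit interval and the Haar measure of the circle\<close>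

lift_definition circle_rep :: "circle \<Rightarrow> real" is frac
  by (auto simp: mod1_eq_def frac_def diff_eq_eq elim!: Ints_cases)

lemma circle_rep_abs: "circle_rep (abs_circle s) = frac s"
  by (rule circle_rep.abs_eq)

lemma circle_rep_bounds: "0 \<le> circle_rep x" "circle_rep x < 1"
  using abs_circle_surj[of x] by (auto simp: circle_rep_abs frac_lt_1)

lemma abs_circle_rep [simp]: "abs_circle (circle_rep x) = x"
  using abs_circle_surj[of x] by (auto simp: circle_rep_abs abs_circle_eq_iff frac_def)

lemma circle_rep_abs_unit: "0 \<le> s \<Longrightarrow> s < 1 \<Longrightarrow> circle_rep (abs_circle s) = s"
  by (simp add: circle_rep_abs frac_eq)

lemma measurable_abs_circle [measurable]: "abs_circle \<in> borel \<rightarrow>\<^sub>M borel"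
  by (intro borel_measurable_continuous_onI continuous_intros)

lemma measurable_circle_rep [measurable]: "circle_rep \<in> borel \<rightarrow>\<^sub>M borel"
proof (subst borel_measurable_iff_greater, intro allI)
  fix a :: real
  show "{x \<in> space borel. a < circle_rep x} \<in> sets borel"
  proof (cases "a < 0")
    case True
    then have "{x \<in> space borel. a < circle_rep x} = UNIV"
      using circle_rep_bounds(1) by (auto intro: less_le_trans)
    then show ?thesis by simp
  next
    case False
    have "{x. a < circle_rep x} = abs_circle ` {a<..<1}"
    proof safe
      fix x assume "a < circle_rep x"
      then have "circle_rep x \<in> {a<..<1}" using circle_rep_bounds(2) by simp
      then show "x \<in> abs_circle ` {a<..<1}" by (metis abs_circle_rep imageI)
    next
      fix s assume "s \<in> {a<..<1}"
      then show "a < circle_rep (abs_circle s)" using False by (simp add: circle_rep_abs_unit)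
    qed
    then show ?thesis by (simp add: open_image_abs_circle borel_open)
  qed
qed

definition circle_measure :: "circle measure" where
  "circle_measure = distr (restrict_space lborel {0..<1}) borel abs_circle"

lemma sets_circle_measure [simp, measurable_cong]: "sets circle_measure = sets borel"
  and space_circle_measure [simp]: "space circle_measure = UNIV"
  by (simp_all add: circle_measure_def)

lemma emeasure_circle_measure:
  assumes "A \<in> sets borel"
  shows "emeasure circle_measure A = emeasure lborel (abs_circle -` A \<inter> {0..<1})"
proof -
  have "abs_circle \<in> restrict_space lborel {0..<1} \<rightarrow>\<^sub>M borel"
    by (intro measurable_restrict_space1) simp
  then show ?thesis
    using assms by (simp add: circle_measure_def emeasure_distr emeasure_restrict_space space_restrict_space)
qed

text \<open>Translation by \<open>c\<close> replaces the fundamental domain [0, 1) by [c, c + 1);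
  the part beyond 1 is moved back to [0, c) by periodicity of the preimage \<open>B\<close>.\<close>

lemma is_haar_prob_circle_measure: "is_haar_prob UNIV circle_measure"
  unfolding is_haar_prob_def
proof (intro conjI ballI)
  show "emeasure circle_measure UNIV = 1"
    by (simp add: emeasure_circle_measure)
  show "sets circle_measure = sets (restrict_space borel UNIV)" by simp
  fix v
  show "distr circle_measure circle_measure ((+) v) = circle_measure"
  proof (rule measure_eqI)
    fix A assume "A \<in> sets (distr circle_measure circle_measure ((+) v))"
    then have A [measurable]: "A \<in> sets borel" by simp
    define c where "c = circle_rep v"
    have c: "0 \<le> c" "c < 1" by (simp_all add: c_def circle_rep_bounds)
    have v: "v = abs_circle c" by (simp add: c_def)
    define B where "B = abs_circle -` A"
    have B [measurable]: "B \<in> sets borel"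
      using measurable_sets[OF measurable_abs_circle A] by (simp add: B_def)
    have period: "1 + s \<in> B \<longleftrightarrow> s \<in> B" for s
    proof -
      have "abs_circle (1 + s) = abs_circle s" by (simp add: abs_circle_eq_iff)
      then show ?thesis by (simp add: B_def)
    qed
    have translate: "emeasure lborel ((+) t -` C) = emeasure lborel C"
      if "C \<in> sets borel" for t :: real and C
    proof -
      have "emeasure lborel C = emeasure (distr lborel borel ((+) t)) C"
        by (simp add: lborel_distr_plus)
      also have "\<dots> = emeasure lborel ((+) t -` C)"
        using that by (simp add: emeasure_distr)
      finally show ?thesis by simp
    qed
    have "emeasure (distr circle_measure circle_measure ((+) v)) A
        = emeasure circle_measure ((+) v -` A)"
      by (subst emeasure_distr) auto
    also have "\<dots> = emeasure lborel (abs_circle -` ((+) v -` A) \<inter> {0..<1})"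
      by (rule emeasure_circle_measure) (use measurable_sets[of "(+) v" borel borel A] in simp)
    also have "abs_circle -` ((+) v -` A) \<inter> {0..<1} = (+) c -` (B \<inter> {c..<c + 1})"
      by (auto simp: B_def v plus_circle.abs_eq)
    also have "emeasure lborel \<dots> = emeasure lborel (B \<inter> {c..<c + 1})"
      by (rule translate) simp
    also have "B \<inter> {c..<c + 1} = B \<inter> {c..<1} \<union> B \<inter> {1..<c + 1}"
      using c by auto
    also have "emeasure lborel \<dots> = emeasure lborel (B \<inter> {c..<1}) + emeasure lborel (B \<inter> {1..<c + 1})"
      by (rule plus_emeasure[symmetric]) auto
    also have "emeasure lborel (B \<inter> {1..<c + 1}) = emeasure lborel ((+) 1 -` (B \<inter> {1..<c + 1}))"
      by (rule translate[symmetric]) simp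
    also have "(+) 1 -` (B \<inter> {1..<c + 1}) = B \<inter> {0..<c}"
      by (auto simp: period)
    also have "emeasure lborel (B \<inter> {c..<1}) + emeasure lborel (B \<inter> {0..<c})
        = emeasure lborel (B \<inter> {c..<1} \<union> B \<inter> {0..<c})"
      by (rule plus_emeasure) auto
    also have "B \<inter> {c..<1} \<union> B \<inter> {0..<c} = B \<inter> {0..<1}"
      using c by auto
    finally show "emeasure (distr circle_measure circle_measure ((+) v)) A = emeasure circle_measure A"
      by (simp add: emeasure_circle_measure B_def)
  qed simp
qed

interpretation circle_measure: prob_space circle_measure
  using is_haar_prob_circle_measure by (auto intro!: prob_spaceI simp: is_haar_prob_def)

lemma emeasure_circle_arc:
  assumes "0 \<le> a" "a \<le> b" "b \<le> 1"
  shows "emeasure circle_measure {x. a \<le> circle_rep x \<and> circle_rep x < b} = ennreal (b - a)"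
proof -
  have "emeasure circle_measure {x. a \<le> circle_rep x \<and> circle_rep x < b}
      = emeasure lborel (abs_circle -` {x. a \<le> circle_rep x \<and> circle_rep x < b} \<inter> {0..<1})"
    by (rule emeasure_circle_measure) measurable
  also have "abs_circle -` {x. a \<le> circle_rep x \<and> circle_rep x < b} \<inter> {0..<1} = {a..<b}"
    using assms by (auto simp: circle_rep_abs_unit)
  finally show ?thesis using assms by simp
qed

section \<open>Coordinates on \<open>V4\<close> and the integral \<open>Lambda4\<close>\<close>

definition V4_param :: "(circle \<times> circle) \<times> (circle \<times> circle \<times> circle) \<Rightarrow> (circle ^ 4) \<times> (circle ^ 4)" where
  "V4_param = (\<lambda>((x, d), (y1, y2, y3)).
     (\<chi> i. if i = 1 then x else if i = 2 then x + d else if i = 3 then x + d + d else x + d + d + d,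
      \<chi> i. if i = 1 then y1 else if i = 2 then y2 else if i = 3 then y3
           else y1 - (y2 + y2 + y2) + (y3 + y3 + y3)))"

text \<open>The pair \<open>(x, d)\<close> is kept apart from the three free \<open>y\<close>
  coordinates, so that for fixed \<open>(x, d)\<close> these can be integrated out first.\<close>

abbreviation param_measure :: "((circle \<times> circle) \<times> (circle \<times> circle \<times> circle)) measure" where
  "param_measure \<equiv> (circle_measure \<Otimes>\<^sub>M circle_measure) \<Otimes>\<^sub>M
     (circle_measure \<Otimes>\<^sub>M (circle_measure \<Otimes>\<^sub>M circle_measure))"

lemma continuous_on_V4_param: "continuous_on UNIV V4_param"
proof -
  have if_const: "continuous_on UNIV (\<lambda>p. if b then u p else v p)"
    if "continuous_on UNIV u" "continuous_on UNIV v"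
    for b and u v :: "(circle \<times> circle) \<times> (circle \<times> circle \<times> circle) \<Rightarrow> circle"
    using that by (cases b) auto
  then show ?thesis
    unfolding V4_param_def case_prod_unfold by (intro if_const continuous_intros)
qed

lemma measurable_V4_param: "V4_param \<in> borel \<rightarrow>\<^sub>M restrict_space borel V4"
proof -
  have "V4_param p \<in> V4" for p
    by (auto simp: V4_param_def V4_def split: prod.split)
  then show ?thesis
    by (intro measurable_restrict_space2 borel_measurable_continuous_onI continuous_on_V4_param) auto
qed

text \<open>\<open>V4_param\<close> identifies the fifth power of the circle with \<open>V4\<close>:
  the first point, the common difference and three of the \<open>y\<close> are free, and the last
  \<open>y\<close> is solved from the linear relation. The inverse \<open>?g\<close> reads these
  parameters off.\<close>

lemma haar_prob_V4: "haar_prob V4 = distr param_measure (restrict_space borel V4) V4_param"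
proof (rule haar_prob_eq_distr)
  let ?g = "\<lambda>v :: (circle ^ 4) \<times> (circle ^ 4).
    ((fst v $ 1, fst v $ 2 - fst v $ 1), (snd v $ 1, snd v $ 2, snd v $ 3))"
  show "is_haar_prob UNIV param_measure"
    by (intro is_haar_prob_pair is_haar_prob_circle_measure)
  show "V4_param \<in> borel \<rightarrow>\<^sub>M restrict_space borel V4"
    by (rule measurable_V4_param)
  show "?g \<in> restrict_space borel V4 \<rightarrow>\<^sub>M borel"
    by (intro measurable_restrict_space1 borel_measurable_continuous_onI continuous_intros)
  show "V4_param (u + w) = V4_param u + V4_param w" for u w
    by (auto simp: V4_param_def vec_eq_iff plus_prod_def algebra_simps split: prod.split)
  show "?g (V4_param u) = u" for u
    by (auto simp: V4_param_def split: prod.split)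
  show "V4_param (?g v) = v" if "v \<in> V4" for v
  proof -
    obtain x y where v: "v = (x, y)" by fastforce
    have x2: "x $ 3 = x $ 2 + (x $ 2 - x $ 1)"
      using that unfolding v V4_def by (simp add: algebra_simps)
    have "x $ 4 - x $ 3 = x $ 2 - x $ 1"
      using that unfolding v V4_def by auto
    then have x3: "x $ 4 = x $ 3 + (x $ 2 - x $ 1)"
      by (simp add: diff_eq_eq add.commute)
    have y: "y $ 4 = y $ 1 - (y $ 2 + y $ 2 + y $ 2) + (y $ 3 + y $ 3 + y $ 3)"
      using that unfolding v V4_def by (simp add: eq_iff_diff_eq_0[symmetric])
    show ?thesis
      by (simp add: v V4_param_def vec_eq_iff forall_4 x2 x3 y)
  qed
qed

lemma prod_4: "prod f (UNIV :: 4 set) = f 1 * f 2 * f 3 * (f 4 :: 'a :: comm_monoid_mult)"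
  unfolding UNIV_4 by (simp add: ac_simps)

lemma Lambda4_eq:
  assumes [measurable]: "F \<in> borel_measurable borel"
  shows "Lambda4 F = (\<integral>((x, d), (y1, y2, y3)). F (x, y1) * F (x + d, y2) * F (x + d + d, y3) *
     F (x + d + d + d, y1 - (y2 + y2 + y2) + (y3 + y3 + y3)) \<partial>param_measure)"
proof -
  have [measurable]: "V4_param \<in> param_measure \<rightarrow>\<^sub>M restrict_space borel V4"
  proof -
    have "sets param_measure = sets borel"
      by (simp add: borel_prod[symmetric] cong: sets_pair_measure_cong)
    from measurable_V4_param show ?thesis
      by (simp only: measurable_cong_sets[OF \<open>sets param_measure = sets borel\<close> refl])
  qed
  define G where "G = (\<lambda>(x, y). \<Prod>i\<in>(UNIV :: 4 set). F (x $ i, y $ i))"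
  have coord: "(\<lambda>p. (fst p $ i, snd p $ i)) \<in> borel \<rightarrow>\<^sub>M borel"
    for i :: 4
    by (intro borel_measurable_continuous_onI continuous_intros)
  have [measurable]: "G \<in> borel_measurable (restrict_space borel V4)"
    unfolding G_def case_prod_unfold
    by (intro measurable_restrict_space1 borel_measurable_prod measurable_compose[OF coord assms])
  \<comment> \<open>For the Borel function \<open>G\<close> the completion does not change the
    integral, so it becomes an integral over the parameters.\<close>
  have "Lambda4 F = integral\<^sup>L param_measure (\<lambda>p. G (V4_param p))"
    unfolding Lambda4_def haar_prob_V4 G_def[symmetric]
    by (subst integral_completion, simp, subst integral_distr) simp_all
  also have "\<dots> = (\<integral>((x, d), (y1, y2, y3)). F (x, y1) * F (x + d, y2) * F (x + d + d, y3) *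
     F (x + d + d + d, y1 - (y2 + y2 + y2) + (y3 + y3 + y3)) \<partial>param_measure)"
  proof (rule Bochner_Integration.integral_cong[OF refl])
    fix p :: "(circle \<times> circle) \<times> (circle \<times> circle \<times> circle)"
    obtain x d y1 y2 y3 where p: "p = ((x, d), (y1, y2, y3))"
      by (metis prod.exhaust)
    show "G (V4_param p) = (\<lambda>((x, d), (y1, y2, y3)). F (x, y1) * F (x + d, y2) * F (x + d + d, y3) *
        F (x + d + d + d, y1 - (y2 + y2 + y2) + (y3 + y3 + y3))) p"
      by (simp add: p G_def V4_param_def prod_4)
  qed
  finally show ?thesis .
qed

lemma borel_measurable_diff_group [measurable (raw)]:
  fixes f g :: "'a \<Rightarrow> 'b::{second_countable_topology, topological_group_add}"
  assumes "f \<in> borel_measurable M" "g \<in> borel_measurable M"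
  shows "(\<lambda>x. f x - g x) \<in> borel_measurable M"
  using assms by (rule borel_measurable_continuous_Pair) (intro continuous_intros)

text \<open>The integrand vanishes unless \<open>d\<close> lies in \<open>D\<close>. Bounding the
  fourth factor by 1 leaves \<open>y1\<close>, \<open>y2\<close>, \<open>y3\<close> independent, and
  each integrates to \<alpha> over its fibre.\<close>

lemma Lambda4_indicator_le:
  fixes S :: "(circle \<times> circle) set"
  assumes [measurable]: "S \<in> sets borel" "D \<in> sets borel"
    and "0 \<le> \<alpha>" and slice: "\<And>x. emeasure circle_measure {y. (x, y) \<in> S} = ennreal \<alpha>"
    and D: "\<And>x d y1 y2 y3. (x, y1) \<in> S \<Longrightarrow> (x + d, y2) \<in> S \<Longrightarrow> (x + d + d, y3) \<in> S \<Longrightarrow>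
        (x + d + d + d, y1 - (y2 + y2 + y2) + (y3 + y3 + y3)) \<in> S \<Longrightarrow> d \<in> D"
  shows "Lambda4 (indicator S) \<le> measure circle_measure D * \<alpha> ^ 3"
proof -
  let ?C = circle_measure
  let ?G = "\<lambda>((x, d), (y1, y2, y3)). indicator S (x, y1) * indicator S (x + d, y2) *
     indicator S (x + d + d, y3) *
     indicator S (x + d + d + d, y1 - (y2 + y2 + y2) + (y3 + y3 + y3)) :: real"
  let ?H = "\<lambda>((x, d), (y1, y2, y3)). indicator D d *
     (indicator S (x, y1) * (indicator S (x + d, y2) * indicator S (x + d + d, y3))) :: ennreal"
  have S' [measurable]: "S \<in> sets (borel \<Otimes>\<^sub>M borel)"
    unfolding borel_prod by (rule assms(1))
  have [measurable]: "?G \<in> borel_measurable param_measure"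
    unfolding case_prod_unfold by measurable
  have [measurable]: "?H \<in> borel_measurable param_measure"
    unfolding case_prod_unfold by measurable
  interpret C2: pair_prob_space ?C ?C ..
  interpret C3: pair_prob_space ?C "?C \<Otimes>\<^sub>M ?C" ..
  have fibre: "(\<integral>\<^sup>+ y. indicator S (x, y) \<partial>?C) = ennreal \<alpha>" for x
  proof -
    have "(\<integral>\<^sup>+ y. indicator S (x, y) \<partial>?C) = (\<integral>\<^sup>+ y. indicator {y. (x, y) \<in> S} y \<partial>?C)"
      by (intro nn_integral_cong) (simp add: indicator_def)
    also have "\<dots> = emeasure ?C {y. (x, y) \<in> S}"
      by (rule nn_integral_indicator) simp
    finally show ?thesis by (simp add: slice)
  qed
  have "Lambda4 (indicator S) = (\<integral>p. ?G p \<partial>param_measure)"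
    by (rule Lambda4_eq) measurable
  also have "\<dots> = enn2real (\<integral>\<^sup>+ p. ennreal (?G p) \<partial>param_measure)"
    by (rule integral_eq_nn_integral) (measurable, auto split: prod.split)
  also have "\<dots> \<le> enn2real (ennreal (measure ?C D * \<alpha> ^ 3))"
  proof (rule enn2real_mono)
    have "(\<integral>\<^sup>+ p. ennreal (?G p) \<partial>param_measure) \<le> (\<integral>\<^sup>+ p. ?H p \<partial>param_measure)"
      by (rule nn_integral_mono) (auto simp: indicator_def dest: D)
    also have "\<dots> = (\<integral>\<^sup>+ q. (\<integral>\<^sup>+ y. ?H (q, y) \<partial>(?C \<Otimes>\<^sub>M (?C \<Otimes>\<^sub>M ?C))) \<partial>(?C \<Otimes>\<^sub>M ?C))"
      by (rule C3.nn_integral_fst[symmetric]) measurable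
    also have "\<dots> = (\<integral>\<^sup>+ q. indicator D (snd q) * ennreal (\<alpha> ^ 3) \<partial>(?C \<Otimes>\<^sub>M ?C))"
    proof (rule nn_integral_cong)
      fix q :: "circle \<times> circle"
      obtain x d where q: "q = (x, d)" by fastforce
      have "(\<integral>\<^sup>+ y. ?H (q, y) \<partial>(?C \<Otimes>\<^sub>M (?C \<Otimes>\<^sub>M ?C)))
          = (\<integral>\<^sup>+ y1. \<integral>\<^sup>+ p. ?H (q, (y1, p)) \<partial>(?C \<Otimes>\<^sub>M ?C) \<partial>?C)"
        by (rule C2.nn_integral_fst[symmetric]) (simp add: q case_prod_unfold, measurable)
      also have "\<dots> = (\<integral>\<^sup>+ y1. \<integral>\<^sup>+ y2. \<integral>\<^sup>+ y3. ?H (q, (y1, y2, y3)) \<partial>?C \<partial>?C \<partial>?C)"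
        by (intro nn_integral_cong circle_measure.nn_integral_fst[symmetric]) (simp add: q case_prod_unfold, measurable)
      also have "\<dots> = indicator D d * ennreal (\<alpha> ^ 3)"
        using \<open>0 \<le> \<alpha>\<close>
        by (simp add: q nn_integral_cmult nn_integral_multc fibre ennreal_mult[symmetric] power3_eq_cube mult.assoc)
      finally show "(\<integral>\<^sup>+ y. ?H (q, y) \<partial>(?C \<Otimes>\<^sub>M (?C \<Otimes>\<^sub>M ?C))) = indicator D (snd q) * ennreal (\<alpha> ^ 3)"
        by (simp add: q)
    qed
    also have "\<dots> = (\<integral>\<^sup>+ x. \<integral>\<^sup>+ d. indicator D d * ennreal (\<alpha> ^ 3) \<partial>?C \<partial>?C)"
      by (subst circle_measure.nn_integral_fst[symmetric]) simp_all
    also have "\<dots> = ennreal (measure ?C D * \<alpha> ^ 3)"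
      using \<open>0 \<le> \<alpha>\<close>
      by (simp add: nn_integral_multc circle_measure.emeasure_eq_measure ennreal_mult
            circle_measure.prob_space[simplified])
    finally show "(\<integral>\<^sup>+ p. ennreal (?G p) \<partial>param_measure) \<le> ennreal (measure ?C D * \<alpha> ^ 3)" .
  qed simp
  also have "\<dots> = measure ?C D * \<alpha> ^ 3"
    using \<open>0 \<le> \<alpha>\<close> by simp
  finally show ?thesis .
qed

section \<open>Riemann integrability of Jordan measurable sets\<close>

text \<open>The frontier is compact and null, so some \<epsilon>-neighbourhood of it lies in an open
  set \<open>U\<close> of measure below \<open>e\<close>. A cell missing the frontier is inside or
  outside \<open>S\<close> and causes no error; all other cells of a fine division lie in
  \<open>U\<close>.\<close>

lemma riemann_integrable_on_cbox_indicator: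
  fixes S :: "'a::euclidean_space set"
  assumes "bounded S" and frontier: "negligible (frontier S)"
    and f: "\<And>z. z \<in> cbox a b \<Longrightarrow> f z = indicator S z"
  shows "riemann_integrable_on_cbox f a b"
  unfolding riemann_integrable_on_cbox_def
proof (rule exI[of _ "measure lebesgue (S \<inter> cbox a b)"], intro allI impI)
  let ?I = "measure lebesgue (S \<inter> cbox a b)"
  fix e :: real assume "0 < e"
  have S: "S \<in> lmeasurable"
    using assms by (intro measurable_Jordan)
  have compact: "compact (frontier S)"
    using \<open>bounded S\<close> by (simp add: compact_frontier_bounded)
  have frontier0: "frontier S \<in> lmeasurable" "measure lebesgue (frontier S) = 0"
    using frontier by (rule negligible_imp_measurable, rule negligible_imp_measure0)
  then obtain U where U: "open U" "frontier S \<subseteq> U" "U - frontier S \<in> lmeasurable"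
      "emeasure lebesgue (U - frontier S) < ennreal e"
    using sets_lebesgue_outer_open[of "frontier S" e] \<open>0 < e\<close> by (auto simp: fmeasurableD)
  have "U = (U - frontier S) \<union> frontier S" using U(2) by auto
  then have U_meas: "U \<in> lmeasurable" "measure lebesgue U = measure lebesgue (U - frontier S)"
    using U(3) frontier0 fmeasurable.Un measure_Un_null_set
    by (metis fmeasurable.Un, metis fmeasurableD measure_Un_null_set negligible_iff_null_sets frontier)
  have U_small: "measure lebesgue U < e"
    using U(3,4) \<open>0 < e\<close> unfolding U_meas(2) by (simp add: emeasure_eq_measure2 ennreal_less_iff)
  from compact U(1,2)
 obtain \<epsilon> where \<epsilon>: "0 < \<epsilon>" "(\<Union>z\<in>frontier S. ball z \<epsilon>) \<subseteq> U"
    by (rule compact_subset_open_imp_ball_epsilon_subset)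
  \<comment> \<open>A cell inside a ball of radius \<open>\<epsilon> / 2\<close> lies in the ball of
    radius \<epsilon> around any of its own points, in particular around a frontier point.\<close>
  have "\<bar>(\<Sum>(x, K)\<in>D. measure lborel K * f x) - ?I\<bar> < e"
    if D: "D tagged_division_of cbox a b" and fine: "(\<lambda>x. ball x (\<epsilon> / 2)) fine D" for D
  proof -
    \<comment> \<open>The cells may share boundaries, so additivity is taken from the integral over
      a tagged division instead of disjointness.\<close>
    have total: "(\<Sum>(x, K)\<in>D. measure lebesgue (T \<inter> K)) = measure lebesgue (T \<inter> cbox a b)"
      if T: "T \<in> lmeasurable" for T
    proof -
      have int: "T \<inter> cbox c d \<in> lmeasurable" for c d
        using T by (intro fmeasurable_Int_fmeasurable) auto
      have "measure lebesgue (T \<inter> cbox a b) = integral (cbox a b) (indicator T)"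
        by (simp add: integral_indicator int)
      also have "\<dots> = (\<Sum>(x, K)\<in>D. integral K (indicator T))"
        by (rule integral_combine_tagged_division_topdown[OF _ D])
           (simp add: integrable_on_indicator int)
      also have "\<dots> = (\<Sum>(x, K)\<in>D. measure lebesgue (T \<inter> K))"
      proof (rule sum.cong, safe)
        fix x K assume "(x, K) \<in> D"
        then obtain c d where "K = cbox c d" using tagged_division_ofD(4)[OF D] by blast
        then show "integral K (indicator T) = measure lebesgue (T \<inter> K)"
          by (simp add: integral_indicator int)
      qed
      finally show ?thesis by simp
    qed
    have "\<bar>measure lborel K * f x - measure lebesgue (S \<inter> K)\<bar> \<le> measure lebesgue (U \<inter> K)"
      if xK: "(x, K) \<in> D" for x K
    proof -
      obtain c d where K: "K = cbox c d" using tagged_division_ofD(4)[OF D xK] by blast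
      have x: "x \<in> K" "K \<subseteq> cbox a b" using tagged_division_ofD(2,3)[OF D xK] by auto
      then have fx: "f x = indicator S x" using f by auto
      have Kball: "K \<subseteq> ball x (\<epsilon> / 2)" using fine xK by (auto simp: fine_def)
      have lK: "measure lborel K = measure lebesgue K" by (simp add: K measure_completion)
      show ?thesis
      proof (cases "K \<inter> frontier S = {}")
        case True
        then have "K \<inter> S = {} \<or> K - S = {}"
          using connected_Int_frontier[of K S] convex_connected[OF convex_box(1)] K by blast
        then show ?thesis
        proof
          assume "K \<inter> S = {}"
          moreover from this have "S \<inter> K = {}" "x \<notin> S" using x by auto
          ultimately show ?thesis by (simp add: fx)
        next
          assume "K - S = {}"
          then have "S \<inter> K = K" "x \<in> S" using x by auto
          then show ?thesis by (simp add: fx lK)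
        qed
      next
        case False
        then obtain z where z: "z \<in> K" "z \<in> frontier S" by auto
        have "K \<subseteq> ball z \<epsilon>"
        proof
          fix y assume "y \<in> K"
          then have "dist x y < \<epsilon> / 2" "dist x z < \<epsilon> / 2" using Kball z by auto
          then show "y \<in> ball z \<epsilon>"
            using dist_triangle_half_r by (auto simp: dist_commute)
        qed
        then have "U \<inter> K = K" using \<epsilon>(2) z by blast
        moreover have "measure lebesgue (S \<inter> K) \<le> measure lebesgue K"
          using S by (intro measure_mono_fmeasurable) (auto simp: K fmeasurableD)
        ultimately show ?thesis by (simp add: fx lK indicator_def)
      qed
    qed
    then have "(\<Sum>(x, K)\<in>D. \<bar>measure lborel K * f x - measure lebesgue (S \<inter> K)\<bar>)
        \<le> (\<Sum>(x, K)\<in>D. measure lebesgue (U \<inter> K))"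
      by (intro sum_mono) auto
    also have "\<dots> \<le> measure lebesgue U"
      unfolding total[OF U_meas(1)] using U_meas(1) by (intro measure_mono_fmeasurable) (auto simp: fmeasurableD)
    finally have "(\<Sum>(x, K)\<in>D. \<bar>measure lborel K * f x - measure lebesgue (S \<inter> K)\<bar>) < e"
      using U_small by simp
    moreover have "(\<Sum>(x, K)\<in>D. measure lborel K * f x) - ?I
        = (\<Sum>(x, K)\<in>D. measure lborel K * f x - measure lebesgue (S \<inter> K))"
      unfolding total[OF S, symmetric] by (simp add: sum_subtractf case_prod_unfold)
    moreover have "\<bar>\<Sum>(x, K)\<in>D. measure lborel K * f x - measure lebesgue (S \<inter> K)\<bar>
        \<le> (\<Sum>(x, K)\<in>D. \<bar>measure lborel K * f x - measure lebesgue (S \<inter> K)\<bar>)"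
      unfolding case_prod_unfold by (rule sum_abs)
    ultimately show ?thesis by linarith
  qed
  then show "\<exists>\<delta>>0. \<forall>D. D tagged_division_of cbox a b \<and> (\<lambda>x. ball x \<delta>) fine D \<longrightarrow>
      \<bar>(\<Sum>(x, K)\<in>D. measure lborel K * f x) - ?I\<bar> < e"
    using \<epsilon>(1) by (intro exI[of _ "\<epsilon> / 2"]) auto
qed

lemma negligible_frontier_UN_convex:
  fixes S :: "'i \<Rightarrow> 'a::euclidean_space set"
  assumes "finite I" "\<And>i. i \<in> I \<Longrightarrow> convex (S i)"
  shows "negligible (frontier (\<Union>i\<in>I. S i))"
proof -
  have "frontier (\<Union>i\<in>I. S i) \<subseteq> (\<Union>i\<in>I. frontier (S i))"
    using frontier_Union_subset[of "S ` I"] \<open>finite I\<close> by auto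
  moreover have "negligible (\<Union>i\<in>I. frontier (S i))"
    using assms by (intro negligible_Union) (auto intro: negligible_convex_frontier)
  ultimately show ?thesis by (rule negligible_subset[rotated])
qed

section \<open>Colorings and digits\<close>

text \<open>The lower digit is colored by \<open>c\<close>, the upper one by \<open>c'\<close>, and
  the two colors are packed into one number in base \<open>r\<close>. The lower digits force
  \<open>N\<close> to divide the difference; the upper digits then exclude what is left.\<close>

lemma coloring_without_symmetric_4AP_mult:
  assumes c: "coloring_without_symmetric_4AP r N c" and c': "coloring_without_symmetric_4AP s M c'"
  shows "coloring_without_symmetric_4AP (r * s) (N * M) (\<lambda>n. c (n mod N) + r * c' (n div N))"
  unfolding coloring_without_symmetric_4AP_def
proof (intro conjI ballI impI)
  have bound: "c (n mod N) < r" "c' (n div N) < s" if "n < N * M" for n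
  proof -
    have "0 < N" using that by (cases N) auto
    then have "n mod N \<in> {0..<N}" by simp
    then show "c (n mod N) < r"
      using c unfolding coloring_without_symmetric_4AP_def by (meson atLeastLessThan_iff image_subset_iff)
    have "n div N < M"
      using that by (simp add: less_mult_imp_div_less mult.commute)
    then have "n div N \<in> {0..<M}" by simp
    then show "c' (n div N) < s"
      using c' unfolding coloring_without_symmetric_4AP_def by (meson atLeastLessThan_iff image_subset_iff)
  qed
  have "c (n mod N) + r * c' (n div N) < r * s" if "n < N * M" for n
  proof -
    have "c (n mod N) + r * c' (n div N) < r * Suc (c' (n div N))"
      using bound(1)[OF that] by simp
    also have "\<dots> \<le> r * s"
      using bound(2)[OF that] by (intro mult_le_mono2) simp
    finally show ?thesis .
  qed
  then show "(\<lambda>n. c (n mod N) + r * c' (n div N)) ` {0..<N * M} \<subseteq> {0..<r * s}"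
    by auto
next
  fix n d
  assume n: "n \<in> {0..<N * M}" and d: "d \<in> {0..<N * M}" and "d \<noteq> 0"
  then have "0 < N" "0 < M" by (cases N; cases M; simp)+
  show "\<not> symmetrically_colored (N * M) (\<lambda>n. c (n mod N) + r * c' (n div N)) n d"
  proof
    assume sym: "symmetrically_colored (N * M) (\<lambda>n. c (n mod N) + r * c' (n div N)) n d"
    have split: "c (a mod N) = c (b mod N) \<and> c' (a div N mod M) = c' (b div N mod M)"
      if "c (a mod (N * M) mod N) + r * c' (a mod (N * M) div N)
        = c (b mod (N * M) mod N) + r * c' (b mod (N * M) div N)" for a b
    proof -
      have lt: "c (m mod N) < r" for m
        using c \<open>0 < N\<close> unfolding coloring_without_symmetric_4AP_def
        by (meson atLeastLessThan_iff image_subset_iff le0 mod_less_divisor)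
      have m: "m mod (N * M) mod N = m mod N" "m mod (N * M) div N = m div N mod M" for m
        using \<open>0 < N\<close> by (simp_all add: mod_mult2_eq mod_mod_cancel)
      have e: "c (a mod N) + r * c' (a div N mod M) = c (b mod N) + r * c' (b div N mod M)"
        using that by (simp only: m)
      have r: "0 < r" using lt[of 0] by simp
      have "(c (m mod N) + r * k) mod r = c (m mod N)" "(c (m mod N) + r * k) div r = k" for m k
        using lt[of m] r by simp_all
      then show ?thesis by (metis e)
    qed
    from sym have s: "c (n mod N) = c ((n + 3 * d) mod N) \<and>
        c' (n div N mod M) = c' ((n + 3 * d) div N mod M)"
      "c ((n + d) mod N) = c ((n + 2 * d) mod N) \<and>
        c' ((n + d) div N mod M) = c' ((n + 2 * d) div N mod M)"
      using split[of n "n + 3 * d"] split[of "n + d" "n + 2 * d"]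
      unfolding symmetrically_colored_def by blast+
    \<comment> \<open>The hypothesis on \<open>c\<close> covers only starts and differences below
      \<open>N\<close>, so both are reduced first.\<close>
    have m: "(n mod N + k * (d mod N)) mod N = (n + k * d) mod N" for k
    proof -
      have "(n mod N + k * (d mod N)) mod N = (n mod N + k * (d mod N) mod N) mod N"
        by (rule mod_add_right_eq[symmetric])
      also have "\<dots> = (n mod N + k * d mod N) mod N"
        by (simp only: mod_mult_right_eq)
      also have "\<dots> = (n + k * d) mod N"
        by (rule mod_add_eq)
      finally show ?thesis .
    qed
    have "symmetrically_colored N c (n mod N) (d mod N)"
      using s m[of 1] m[of 2] m[of 3] by (simp add: symmetrically_colored_def)
    then have "d mod N = 0"
      using c \<open>0 < N\<close> unfolding coloring_without_symmetric_4AP_def by (meson atLeastLessThan_iff le0 mod_less_divisor)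
    then obtain e where e: "d = N * e" by auto
    have e': "e < M" "e \<noteq> 0" using d \<open>d \<noteq> 0\<close> unfolding e by simp_all
    \<comment> \<open>Adding multiples of \<open>N\<close> leaves the lower digit unchanged, so no
      carry disturbs the progression of upper digits.\<close>
    have q: "(n + k * d) div N mod M = (n div N mod M + k * e) mod M" for k
    proof -
      have "(n + k * d) div N = n div N + k * e"
        using \<open>0 < N\<close> unfolding e mult.left_commute[of k N e] by simp
      then show ?thesis by (simp only: mod_add_left_eq)
    qed
    have "symmetrically_colored M c' (n div N mod M) e"
      using s q[of 1] q[of 2] q[of 3] by (simp add: symmetrically_colored_def)
    then show False
      using c' e' \<open>0 < M\<close> unfolding coloring_without_symmetric_4AP_def by auto
  qed
qed

lemma coloring_without_symmetric_4AP_power: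
  assumes "coloring_without_symmetric_4AP r N c"
  shows "\<exists>c. coloring_without_symmetric_4AP (r ^ k) (N ^ k) c"
proof (induction k)
  case 0
  \<comment> \<open>Vacuous, since modulo 1 there is no nonzero difference.\<close>
  have "coloring_without_symmetric_4AP 1 1 (\<lambda>_. 0)"
    by (simp add: coloring_without_symmetric_4AP_def)
  then show ?case by auto
next
  case (Suc k)
  then show ?case
    using coloring_without_symmetric_4AP_mult[OF assms] by auto
qed

section \<open>Integers with base-9 digits 0, 1, 2\<close>

text \<open>Replaces the base-3 digits of a number by the same digits in base 9. Since base-9 digits in
  \<open>{0, \<dots>, 8}\<close> are uniquely \<open>x + 3 * y\<close> with \<open>x, y < 3\<close>, the equation in \<open>spread_unique\<close> has only
  trivial solutions.\<close>

fun spread :: "nat \<Rightarrow> nat" where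
  "spread n = (if n = 0 then 0 else n mod 3 + 9 * spread (n div 3))"

declare spread.simps [simp del]

lemma spread_rec: "spread n = n mod 3 + 9 * spread (n div 3)"
  by (cases "n = 0") (simp_all add: spread.simps)

text \<open>Follows from \<open>e \<le> e^2\<close> for the last digit and
  \<open>9 * q^2 + e^2 \<le> (3 * q + e)^2\<close>. This quadratic growth is the origin of the
  factor 1/2 in the final exponent.\<close>

lemma spread_le_square: "spread n \<le> n\<^sup>2"
proof (induction n rule: spread.induct)
  case (1 n)
  show ?case
  proof (cases "n = 0")
    case False
    define q e where "q = n div 3" and "e = n mod 3"
    have n: "n = 3 * q + e" by (simp add: q_def e_def)
    have "spread n = e + 9 * spread q"
      using spread_rec[of n] by (simp add: q_def e_def)
    also have "\<dots> \<le> e\<^sup>2 + 9 * q\<^sup>2"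
      using 1[OF False] by (simp add: q_def power2_eq_square add_mono)
    also have "\<dots> \<le> n\<^sup>2"
      unfolding n by (simp add: power2_eq_square algebra_simps)
    finally show ?thesis .
  qed (simp add: spread.simps)
qed

lemma spread_unique:
  assumes "spread a + 3 * spread b = spread a' + 3 * spread b'"
  shows "a = a' \<and> b = b'"
  using assms
proof (induction "a + b + a' + b'" arbitrary: a b a' b' rule: less_induct)
  case less
  show ?case
  proof (cases "a + b + a' + b' = 0")
    case False
    \<comment> \<open>Three readings of one number: \<open>x\<close> and \<open>y\<close> are its
      two lowest base-3 digits and \<open>m\<close> is the rest. Applied to both sides of the
      equation, they yield the equality of digits and the equation for the induction.\<close>
    have digits: "(x + 3 * y + 9 * m) mod 3 = x" "(x + 3 * y + 9 * m) div 3 mod 3 = y"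
        "(x + 3 * y + 9 * m) div 3 div 3 = m" if "x < 3" "y < 3" for x y m :: nat
    proof -
      have regroup: "x + 3 * y + 9 * m = x + 3 * (y + 3 * m)" by simp
      show "(x + 3 * y + 9 * m) mod 3 = x" "(x + 3 * y + 9 * m) div 3 mod 3 = y"
        "(x + 3 * y + 9 * m) div 3 div 3 = m"
        unfolding regroup using that by (simp_all only: mod_mult_self2 div_mult_self2 mod_less div_less) simp_all
    qed
    have expand: "spread n + 3 * spread n' = n mod 3 + 3 * (n' mod 3) + 9 * (spread (n div 3) + 3 * spread (n' div 3))"
      for n n'
      by (subst (1 2) spread_rec) (simp add: algebra_simps)
    have lt: "n mod 3 < 3" for n :: nat by simp
    note eq = less.prems[unfolded expand[of a b] expand[of a' b']]
    have h: "a mod 3 = a' mod 3" "b mod 3 = b' mod 3"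
      "spread (a div 3) + 3 * spread (b div 3) = spread (a' div 3) + 3 * spread (b' div 3)"
      using arg_cong[OF eq, of "\<lambda>z. z mod 3"] arg_cong[OF eq, of "\<lambda>z. z div 3 mod 3"]
        arg_cong[OF eq, of "\<lambda>z. z div 3 div 3"]
      by (simp_all only: digits[OF lt lt])
    have "a div 3 + b div 3 + a' div 3 + b' div 3 < a + b + a' + b'"
      using False by linarith
    from less.hyps[OF this h(3)] h(1,2) show ?thesis
      by (metis mult_div_mod_eq)
  qed simp
qed

text \<open>\<open>U\<close> and \<open>W\<close> are the start and difference of a progression on
  the circle, scaled by \<open>3 * N\<close>, and \<open>J i\<close> is the arc of its i-th point.
  Equal positions in the blocks make the rounding uniform, so the blocks form an exact progression
  modulo \<open>N\<close>, to which the coloring applies. The two alternatives are a difference just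
  above 0 and one just below a full turn.\<close>

lemma block_coloring_symmetric:
  fixes L N r :: nat and U W :: real
  assumes c: "coloring_without_symmetric_4AP r N c" and "0 < N"
    and W: "0 \<le> W" "W < 3 * N"
    and J: "\<And>i. J i = nat (\<lfloor>U + of_nat i * W\<rfloor> mod (3 * int N))"
    and col: "\<And>j. col j = 3 * c (j div 3) + j mod 3"
    and sym: "col (J 0) = col (J 3)" "col (J 1) = col (J 2)"
  shows "W < 1 \<or> 3 * N - 1 \<le> W"
proof -
  define I where "I i = \<lfloor>U + of_nat i * W\<rfloor>" for i :: nat
  define w where "w = \<lfloor>W\<rfloor>"
  have step: "I (Suc i) - I i = w \<or> I (Suc i) - I i = w + 1" for i
  proof -
    have "U + of_nat (Suc i) * W = (U + of_nat i * W) + W" by (simp add: algebra_simps)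
    then show ?thesis unfolding I_def w_def by linarith
  qed
  have JI: "int (J i) = I i mod (3 * int N)" for i
    using \<open>0 < N\<close> by (simp add: J I_def)
  have col_eqD: "j mod 3 = j' mod 3 \<and> c (j div 3) = c (j' div 3)" if "col j = col j'" for j j'
    using that unfolding col by presburger
  have J3: "int (J i mod 3) = I i mod 3" for i
  proof -
    have "int (J i mod 3) = (I i mod (3 * int N)) mod 3"
      using JI[of i] by (metis of_nat_mod of_nat_numeral)
    then show ?thesis by (simp add: mod_mod_cancel)
  qed
  have "I 0 mod 3 = I 3 mod 3" "I 1 mod 3 = I 2 mod 3"
    using col_eqD[OF sym(1)] col_eqD[OF sym(2)] J3 by metis+
  then have dvd: "3 dvd I 3 - I 0" "3 dvd I 2 - I 1"
    by (metis mod_eq_dvd_iff)+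
  (* The rounding errors x, y, z lie in {0, 1} and have a sum divisible by 3, so they are equal. *)
  define x y z where "x = I 1 - I 0 - w" and "y = I 2 - I 1 - w" and "z = I 3 - I 2 - w"
  have xyz: "x \<in> {0, 1}" "y \<in> {0, 1}" "z \<in> {0, 1}"
      "I 1 = I 0 + w + x" "I 2 = I 1 + w + y" "I 3 = I 2 + w + z"
    using step[of 0] step[of 1] step[of 2]
    by (auto simp: numeral_eq_Suc x_def y_def z_def)
  have "I 3 - I 0 = 3 * w + (x + y + z)" using xyz by simp
  with dvd(1) have "3 dvd x + y + z" by presburger
  with xyz have eq: "x = y" "z = y" by auto
  \<comment> \<open>All three steps of the arc indices equal \<open>w + y\<close>, which is also the
    middle step and hence divisible by 3; the blocks advance by \<open>e\<close> each time.\<close>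
  from dvd(2) xyz eq obtain e where "w + y = 3 * e" by (auto simp: algebra_simps elim!: dvdE)
  with xyz eq have "\<exists>e. (w = 3 * e \<or> w + 1 = 3 * e) \<and> I 1 = I 0 + 3 * e \<and> I 2 = I 0 + 6 * e \<and> I 3 = I 0 + 9 * e"
    by (intro exI[of _ e]) auto
  then obtain e where e: "w = 3 * e \<or> w + 1 = 3 * e"
      "I 1 = I 0 + 3 * e" "I 2 = I 0 + 6 * e" "I 3 = I 0 + 9 * e"
    by blast
  have w0: "0 \<le> w" "w < 3 * int N" using W by (auto simp: w_def floor_less_iff)
  with e(1) have e0: "0 \<le> e" "e \<le> int N" by linarith+
  define n where "n = J 0 div 3"
  have Jdiv: "J i div 3 = (n + k * nat e) mod N" if "I i = I 0 + 3 * (int k * e)" for i k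
  proof -
    have mm: "int (J i div 3) = I i div 3 mod int N" for i
      using zdiv_int[of "J i" 3] JI[of i] \<open>0 < N\<close>
      by (simp add: mod_mult2_eq' zmod_zmult2_eq)
    have "int (J i div 3) = (I 0 div 3 + int k * e) mod int N"
      using mm[of i] that by (simp add: add.commute)
    also have "\<dots> = (int n + int k * e) mod int N"
      using mm[of 0] unfolding n_def by (metis mod_add_left_eq)
    also have "\<dots> = int ((n + k * nat e) mod N)"
      using e0 by (simp add: of_nat_mod)
    finally show ?thesis by simp
  qed
  have n: "n < N"
  proof -
    have "int (J 0) < 3 * int N" using JI[of 0] \<open>0 < N\<close> by simp
    then show ?thesis unfolding n_def by linarith
  qed
  have Jd: "J 0 div 3 = n mod N" "J 1 div 3 = (n + nat e) mod N" "J 2 div 3 = (n + 2 * nat e) mod N"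
     "J 3 div 3 = (n + 3 * nat e) mod N"
    using Jdiv[of 0 0] Jdiv[of 1 1] Jdiv[of 2 2] Jdiv[of 3 3] e by simp_all
  have "symmetrically_colored N c n (nat e)"
    using col_eqD[OF sym(1)] col_eqD[OF sym(2)] unfolding symmetrically_colored_def Jd by blast
  moreover have "n \<in> {0..<N}" using n by simp
  ultimately have "nat e \<in> {0..<N} \<Longrightarrow> nat e = 0"
    using c unfolding coloring_without_symmetric_4AP_def by blast
  \<comment> \<open>The value \<open>e = int N\<close> lies outside the range of differences of the
    coloring. It arises by rounding up from \<open>w = 3 * int N - 1\<close>, a difference just
    below a full turn.\<close>
  then have "e = 0 \<or> e = int N" using e0 by auto
  with e(1) w0 \<open>0 < N\<close> have "w = 0 \<or> w = 3 * int N - 1" by auto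
  then show ?thesis unfolding w_def by linarith
qed

section \<open>Strips over the circle\<close>

text \<open>The circle is cut into \<open>L\<close> equal arcs, and the floor is the index of the
  arc containing \<open>x\<close>; \<open>p\<close> assigns to each arc the left end of the interval
  for \<open>y\<close>.\<close>

definition strip_set :: "nat \<Rightarrow> (nat \<Rightarrow> real) \<Rightarrow> real \<Rightarrow> (circle \<times> circle) set" where
  "strip_set L p \<alpha> = {(x, y). p (nat \<lfloor>L * circle_rep x\<rfloor>) \<le> circle_rep y \<and>
      circle_rep y < p (nat \<lfloor>L * circle_rep x\<rfloor>) + \<alpha>}"

lemma strip_set_borel: "strip_set L p \<alpha> \<in> sets borel"
proof -
  have [measurable]: "(\<lambda>x. p (nat \<lfloor>real L * circle_rep x\<rfloor>)) \<in> borel_measurable borel"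
    by (rule measurable_compose[of "\<lambda>x. \<lfloor>real L * circle_rep x\<rfloor>" _ "count_space UNIV"]) auto
  have "strip_set L p \<alpha> = {q \<in> space (borel \<Otimes>\<^sub>M borel).
      p (nat \<lfloor>L * circle_rep (fst q)\<rfloor>) \<le> circle_rep (snd q) \<and>
      circle_rep (snd q) < p (nat \<lfloor>L * circle_rep (fst q)\<rfloor>) + \<alpha>}"
    by (auto simp: strip_set_def space_pair_measure)
  also have "\<dots> \<in> sets (borel \<Otimes>\<^sub>M borel)" by measurable
  finally show ?thesis by (simp only: borel_prod)
qed

text \<open>Passing to \<open>frac z\<close> changes \<open>L * z\<close> by a multiple of
  \<open>L\<close>. Arc indices can thus be computed from the unreduced real terms of a
  progression.\<close>

lemma floor_mult_frac:
  fixes L :: nat and z :: real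
  assumes "0 < L"
  shows "\<lfloor>L * frac z\<rfloor> = \<lfloor>L * z\<rfloor> mod int L"
proof -
  have "real L * frac z = real L * z - of_int (int L * \<lfloor>z\<rfloor>)"
    by (simp add: frac_def algebra_simps)
  then have e: "\<lfloor>L * frac z\<rfloor> = \<lfloor>L * z\<rfloor> - int L * \<lfloor>z\<rfloor>"
    by (simp only: floor_diff_of_int)
  have "0 \<le> \<lfloor>L * frac z\<rfloor>" "\<lfloor>L * frac z\<rfloor> < int L"
    using assms by (auto simp: floor_less_iff frac_lt_1)
  then have "\<lfloor>L * frac z\<rfloor> = \<lfloor>L * frac z\<rfloor> mod int L" by simp
  also have "\<dots> = \<lfloor>L * z\<rfloor> mod int L" unfolding e by (simp add: mod_diff_right_eq flip: mod_diff_eq)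
  finally show ?thesis .
qed

lemma nat_floor_frac_less:
  assumes "0 < L"
  shows "nat \<lfloor>real L * frac s\<rfloor> < L"
  using assms by (simp add: floor_mult_frac nat_less_iff)

text \<open>The right end 1 represents the same point as 0, so it belongs to the strip exactly when
  the strip starts at 0.\<close>

lemma frac_in_strip_iff:
  assumes "0 \<le> t" "t \<le> 1" "0 \<le> q" "q + \<alpha> \<le> 1" "0 < \<alpha>"
  shows "q \<le> frac t \<and> frac t < q + \<alpha> \<longleftrightarrow> t \<in> {q..<q + \<alpha>} \<or> (t = 1 \<and> q = 0)"
proof (cases "t = 1")
  case False
  then have "frac t = t" using assms by (simp add: frac_eq)
  then show ?thesis using False by auto
qed (use assms in auto)

text \<open>On the closed unit square the strip set is a finite union of rectangles, some
  degenerate. These are convex, so the frontier of the union is negligible.\<close>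

lemma torus_riemann_integrable_strip_set:
  assumes "0 < L" "0 < \<alpha>" and p: "\<And>j. j < L \<Longrightarrow> 0 \<le> p j \<and> p j + \<alpha> \<le> 1"
  shows "torus_riemann_integrable (indicator (strip_set L p \<alpha>))"
proof -
  (* The one-point pieces come from the right end 1 of the unit interval, which is identified with 0. *)
  define X where "X = (\<lambda>(j, b). if b then {real j / L..<real (Suc j) / L} else if j = 0 then {1} else {})"
  define Y where "Y = (\<lambda>(j, b). if b then {p j..<p j + \<alpha>} else if p j = 0 then {1} else {})"
  define S where "S = (\<Union>(j, b, b')\<in>{..<L} \<times> (UNIV :: (bool \<times> bool) set). X (j, b) \<times> Y (j, b'))"
  have cell: "nat \<lfloor>real L * frac s\<rfloor> = j \<longleftrightarrow> s \<in> X (j, True) \<or> s \<in> X (j, False)"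
    if "0 \<le> s" "s \<le> 1" "j < L" for s j
  proof (cases "s = 1")
    case True
    then show ?thesis using that by (auto simp: X_def field_simps)
  next
    case False
    then have "frac s = s" using that by (simp add: frac_eq)
    moreover have "nat \<lfloor>real L * s\<rfloor> = j \<longleftrightarrow> \<lfloor>real L * s\<rfloor> = int j"
      using that by auto
    ultimately show ?thesis
      using False \<open>0 < L\<close> by (auto simp: X_def floor_eq_iff field_simps)
  qed
  have S_iff: "(s, t) \<in> S \<longleftrightarrow> (abs_circle s, abs_circle t) \<in> strip_set L p \<alpha>"
    if s: "0 \<le> s" "s \<le> 1" and t: "0 \<le> t" "t \<le> 1" for s t
  proof -
    define j where "j = nat \<lfloor>real L * frac s\<rfloor>"
    have j: "j < L" using \<open>0 < L\<close> by (simp add: j_def nat_floor_frac_less)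
    have "(s, t) \<in> S \<longleftrightarrow> (\<exists>i<L. (s \<in> X (i, True) \<or> s \<in> X (i, False)) \<and> (t \<in> Y (i, True) \<or> t \<in> Y (i, False)))"
      by (auto simp: S_def ex_bool_eq)
    also have "\<dots> \<longleftrightarrow> (\<exists>i<L. j = i \<and> (t \<in> Y (i, True) \<or> t \<in> Y (i, False)))"
      using cell[OF s] by (auto simp: j_def)
    also have "\<dots> \<longleftrightarrow> t \<in> Y (j, True) \<or> t \<in> Y (j, False)"
      using j by auto
    also have "\<dots> \<longleftrightarrow> p j \<le> frac t \<and> frac t < p j + \<alpha>"
      using frac_in_strip_iff[OF t] p[OF j] \<open>0 < \<alpha>\<close> by (auto simp: Y_def)
    finally show ?thesis
      by (simp add: strip_set_def circle_rep_abs j_def)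
  qed
  have "negligible (frontier S)"
    unfolding S_def by (rule negligible_frontier_UN_convex) (auto simp: X_def Y_def intro!: convex_Times)
  moreover have "bounded S"
  proof -
    have "bounded (X q)" "bounded (Y q)" for q
      by (auto simp: X_def Y_def split: prod.split)
    then show ?thesis
      unfolding S_def by (intro bounded_UN) (auto intro: bounded_Times)
  qed
  moreover have "(case z of (s, t) \<Rightarrow> indicator (strip_set L p \<alpha>) (abs_circle s, abs_circle t)) = indicator S z"
    if "z \<in> cbox (0, 0) (1, 1)" for z
    using that S_iff by (auto simp: indicator_def cbox_Pair_eq)
  ultimately show ?thesis
    unfolding torus_riemann_integrable_def by (intro riemann_integrable_on_cbox_indicator) auto
qed

lemma constant_first_marginal_strip_set:
  assumes "0 < L" "0 < \<alpha>" and p: "\<And>j. j < L \<Longrightarrow> 0 \<le> p j \<and> p j + \<alpha> \<le> 1"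
  shows "constant_first_marginal (indicator (strip_set L p \<alpha>)) \<alpha>"
proof -
  have "((\<lambda>t. indicator (strip_set L p \<alpha>) (abs_circle s, abs_circle t)) has_integral \<alpha>) {0..1}" for s
  proof -
    define q where "q = p (nat \<lfloor>real L * frac s\<rfloor>)"
    have q: "0 \<le> q" "q + \<alpha> \<le> 1"
      using p \<open>0 < L\<close> by (simp_all add: q_def nat_floor_frac_less)
    have meas: "{q..<q + \<alpha>} \<in> lmeasurable"
      by (intro bounded_set_imp_lmeasurable) auto
    from q have int: "{q..<q + \<alpha>} \<inter> {0..1} = {q..<q + \<alpha>}" by auto
    have "indicat_real {q..<q + \<alpha>} integrable_on {0..1}"
      by (simp add: integrable_on_indicator int meas)
    moreover have "integral {0..1} (indicat_real {q..<q + \<alpha>}) = \<alpha>"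
      using \<open>0 < \<alpha>\<close> by (simp add: integral_indicator int meas)
    ultimately have "(indicat_real {q..<q + \<alpha>} has_integral \<alpha>) {0..1}"
      by (simp add: has_integral_iff)
    then show ?thesis
    \<comment> \<open>The integrands can differ only at \<open>t = 1\<close>, where
      \<open>frac\<close> drops to 0.\<close>
    proof (rule has_integral_spike_finite[rotated 2])
      fix t :: real assume "t \<in> {0..1} - {1}"
      then have "frac t = t" by (simp add: frac_eq)
      then show "indicator (strip_set L p \<alpha>) (abs_circle s, abs_circle t) = indicat_real {q..<q + \<alpha>} t"
        by (auto simp: strip_set_def indicator_def circle_rep_abs q_def)
    qed simp
  qed
  then show ?thesis by (simp add: constant_first_marginal_def)
qed

section \<open>Upper bounds for \<open>rho4\<close>\<close>

lemma rho4_le: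
  assumes "range F \<subseteq> {0..1}" "torus_riemann_integrable F" "constant_first_marginal F \<alpha>"
  shows "rho4 \<alpha> \<le> Lambda4 F"
  unfolding rho4_def
proof (rule cInf_lower)
  have "0 \<le> Lambda4 G" if "range G \<subseteq> {0..1}" for G
  proof -
    have "0 \<le> G z" for z using that by (meson atLeastAtMost_iff image_subset_iff UNIV_I)
    then show ?thesis
      unfolding Lambda4_def by (intro Bochner_Integration.integral_nonneg) (auto intro: prod_nonneg)
  qed
  then show "bdd_below {Lambda4 F | F. range F \<subseteq> {0..1} \<and> torus_riemann_integrable F \<and>
      constant_first_marginal F \<alpha>}"
    by (intro bdd_belowI[of _ 0]) auto
qed (use assms in blast)

text \<open>Leaves only the question which differences \<open>d\<close> can occur between points of
  the strip set.\<close>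

lemma rho4_le_strip_set:
  assumes "0 < L" "0 < \<alpha>" and p: "\<And>j. j < L \<Longrightarrow> 0 \<le> p j \<and> p j + \<alpha> \<le> 1"
    and "D \<in> sets borel"
    and D: "\<And>x d y1 y2 y3. (x, y1) \<in> strip_set L p \<alpha> \<Longrightarrow> (x + d, y2) \<in> strip_set L p \<alpha> \<Longrightarrow>
        (x + d + d, y3) \<in> strip_set L p \<alpha> \<Longrightarrow>
        (x + d + d + d, y1 - (y2 + y2 + y2) + (y3 + y3 + y3)) \<in> strip_set L p \<alpha> \<Longrightarrow> d \<in> D"
  shows "rho4 \<alpha> \<le> measure circle_measure D * \<alpha> ^ 3"
proof -
  have slice: "emeasure circle_measure {y. (x, y) \<in> strip_set L p \<alpha>} = ennreal \<alpha>" for x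
  proof -
    obtain s where s: "x = abs_circle s" using abs_circle_surj by metis
    show ?thesis
      using emeasure_circle_arc[of "p (nat \<lfloor>real L * frac s\<rfloor>)" "p (nat \<lfloor>real L * frac s\<rfloor>) + \<alpha>"]
        p[OF nat_floor_frac_less[OF \<open>0 < L\<close>, of s]] \<open>0 < \<alpha>\<close>
      by (simp add: strip_set_def s circle_rep_abs)
  qed
  have "rho4 \<alpha> \<le> Lambda4 (indicator (strip_set L p \<alpha>))"
    using torus_riemann_integrable_strip_set[OF assms(1-3)] constant_first_marginal_strip_set[OF assms(1-3)]
    by (intro rho4_le) (auto simp: indicator_def)
  also have "\<dots> \<le> measure circle_measure D * \<alpha> ^ 3"
    using slice D \<open>0 < \<alpha>\<close> \<open>D \<in> sets borel\<close> strip_set_borel by (intro Lambda4_indicator_le) auto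
  finally show ?thesis .
qed

text \<open>A single strip over the whole circle with \<open>D = UNIV\<close>. It serves the
  \<alpha> that are too large for the next bound.\<close>

lemma rho4_le_cube:
  assumes "0 < \<alpha>" "\<alpha> < 1"
  shows "rho4 \<alpha> \<le> \<alpha> ^ 3"
  using rho4_le_strip_set[of 1 \<alpha> "\<lambda>_. 0" UNIV] assms
  by (simp add: circle_measure.prob_space[simplified])

text \<open>The relation between the \<open>y\<close> carries over to the left ends up to an error
  below \<open>4 * \<alpha>\<close>. This is at most their spacing, so it holds exactly for the
  \<open>spread\<close> values, which forces a symmetric coloring and hence a tiny \<open>d\<close>.
  The constant is 288 = 32 * 9, with 9 from the \<open>3 * r\<close> colors and 32 = 8 * 4 from the
  spacing and the error.\<close>

lemma rho4_le_of_coloring: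
  assumes c: "coloring_without_symmetric_4AP r N c" and "0 < N" "0 < \<alpha>"
    and \<alpha>: "288 * (real r)\<^sup>2 * \<alpha> \<le> 1"
  shows "rho4 \<alpha> \<le> 2 / (3 * real N) * \<alpha> ^ 3"
proof -
  define L R where "L = 3 * N" and "R = 3 * r"
  define col where "col j = 3 * c (j div 3) + j mod 3" for j
  \<comment> \<open>Since \<open>spread\<close> of a color stays below \<open>R^2\<close>, the
    factor 8 puts all strips into [0, 1/8], which rules out wraparound below.\<close>
  define p where "p j = real (spread (col j)) / (8 * (real R)\<^sup>2)" for j
  have "0 < L" using \<open>0 < N\<close> by (simp add: L_def)
  have "c 0 < r"
    using c \<open>0 < N\<close> unfolding coloring_without_symmetric_4AP_def
    by (meson atLeastLessThan_iff image_subset_iff le0)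
  then have "0 < R" by (simp add: R_def)
  have \<alpha>R: "32 * (real R)\<^sup>2 * \<alpha> \<le> 1"
    using \<alpha> by (simp add: R_def power_mult_distrib)
  have p: "0 \<le> p j \<and> p j + \<alpha> \<le> 1 / 8" if "j < L" for j
  proof -
    have "j div 3 \<in> {0..<N}" using that by (auto simp: L_def)
    then have "c (j div 3) < r"
      using c unfolding coloring_without_symmetric_4AP_def
      by (meson atLeastLessThan_iff image_subset_iff)
    then have "col j + 1 \<le> R" unfolding col_def R_def by linarith
    have "spread (col j) + 1 \<le> (col j)\<^sup>2 + 1" using spread_le_square by simp
    also have "\<dots> \<le> (col j + 1)\<^sup>2" by (simp add: power2_eq_square)
    also have "\<dots> \<le> R\<^sup>2" using \<open>col j + 1 \<le> R\<close> by (rule power_mono) simp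
    finally have "real (spread (col j)) + 1 \<le> (real R)\<^sup>2"
      by (metis of_nat_1 of_nat_add of_nat_le_iff of_nat_power)
    then have "real (spread (col j)) + 8 * (real R)\<^sup>2 * \<alpha> \<le> (real R)\<^sup>2"
      using \<alpha>R by linarith
    moreover have "p j + \<alpha> = (real (spread (col j)) + 8 * (real R)\<^sup>2 * \<alpha>) / (8 * (real R)\<^sup>2)"
      using \<open>0 < R\<close> by (simp add: p_def field_simps)
    ultimately have "p j + \<alpha> \<le> (real R)\<^sup>2 / (8 * (real R)\<^sup>2)"
      by (auto intro: divide_right_mono)
    then have "p j + \<alpha> \<le> 1 / 8"
      using \<open>0 < R\<close> by simp
    then show ?thesis by (simp add: p_def)
  qed
  \<comment> \<open>One arc of length \<open>1 / L\<close> on each side of 0, for small positive and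
    small negative differences.\<close>
  define D where "D = {d. 0 \<le> circle_rep d \<and> circle_rep d < 1 / L} \<union>
    {d. 1 - 1 / L \<le> circle_rep d \<and> circle_rep d < 1}"
  have D_meas: "{d. a \<le> circle_rep d \<and> circle_rep d < b} \<in> sets borel" for a b by measurable
  then have D_borel: "D \<in> sets borel" unfolding D_def by blast
  have "d \<in> D"
    if y1: "(x, y1) \<in> strip_set L p \<alpha>" and y2: "(x + d, y2) \<in> strip_set L p \<alpha>"
      and y3: "(x + d + d, y3) \<in> strip_set L p \<alpha>"
      and y4: "(x + d + d + d, y1 - (y2 + y2 + y2) + (y3 + y3 + y3)) \<in> strip_set L p \<alpha>"
    for x d y1 y2 y3
  proof -
    define s t where "s = circle_rep x" and "t = circle_rep d"
    have xd: "x = abs_circle s" "d = abs_circle t" by (simp_all add: s_def t_def)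
    have t: "0 \<le> t" "t < 1" by (simp_all add: t_def circle_rep_bounds)
    define J where "J i = nat (\<lfloor>L * s + of_nat i * (L * t)\<rfloor> mod (3 * int N))" for i :: nat
    have J: "nat \<lfloor>L * circle_rep z\<rfloor> = J i" if "z = abs_circle (s + of_nat i * t)" for z i
    proof -
      have "\<lfloor>L * circle_rep z\<rfloor> = \<lfloor>L * (s + of_nat i * t)\<rfloor> mod int L"
        unfolding that circle_rep_abs using \<open>0 < L\<close> by (rule floor_mult_frac)
      then show ?thesis by (simp add: J_def L_def algebra_simps)
    qed
    have J_less: "J i < L" for i
      using \<open>0 < N\<close> by (simp add: J_def L_def nat_less_iff)
    have pts: "x = abs_circle (s + of_nat 0 * t)" "x + d = abs_circle (s + of_nat 1 * t)"
      "x + d + d = abs_circle (s + of_nat 2 * t)" "x + d + d + d = abs_circle (s + of_nat 3 * t)"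
      by (simp_all add: xd plus_circle.abs_eq algebra_simps)
    define a1 a2 a3 where "a1 = circle_rep y1" and "a2 = circle_rep y2" and "a3 = circle_rep y3"
    define a4 where "a4 = circle_rep (y1 - (y2 + y2 + y2) + (y3 + y3 + y3))"
    have a: "p (J 0) \<le> a1" "a1 < p (J 0) + \<alpha>" "p (J 1) \<le> a2" "a2 < p (J 1) + \<alpha>"
      "p (J 2) \<le> a3" "a3 < p (J 2) + \<alpha>" "p (J 3) \<le> a4" "a4 < p (J 3) + \<alpha>"
      using y1 y2 y3 y4 J[OF pts(1)] J[OF pts(2)] J[OF pts(3)] J[OF pts(4)]
      by (simp_all add: strip_set_def a1_def a2_def a3_def a4_def)
    have "abs_circle a4 = abs_circle a1 - (abs_circle a2 + abs_circle a2 + abs_circle a2) +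
        (abs_circle a3 + abs_circle a3 + abs_circle a3)"
      by (simp add: a1_def a2_def a3_def a4_def)
    also have "\<dots> = abs_circle (a1 - (a2 + a2 + a2) + (a3 + a3 + a3))"
      by (simp only: plus_circle.abs_eq minus_circle.abs_eq)
    finally have "a4 - (a1 - (a2 + a2 + a2) + (a3 + a3 + a3)) \<in> \<int>"
      by (simp only: abs_circle_eq_iff)
    \<comment> \<open>All four numbers lie in [0, 1/8) and have coefficients 1, 3, 3, 1, so the
      relation modulo 1 is an equation between reals.\<close>
    moreover have "\<bar>a4 - (a1 - (a2 + a2 + a2) + (a3 + a3 + a3))\<bar> < 1"
      using a p[OF J_less, of 0] p[OF J_less, of 1] p[OF J_less, of 2] p[OF J_less, of 3] by linarith
    ultimately have "a4 - (a1 - (a2 + a2 + a2) + (a3 + a3 + a3)) = 0"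
      using Ints_nonzero_abs_less1 by blast
    \<comment> \<open>Each \<open>a\<close> exceeds its left end by less than \<alpha>, and the
      coefficients on either side of the equation add up to 4.\<close>
    then have "\<bar>p (J 0) + 3 * p (J 2) - (p (J 3) + 3 * p (J 1))\<bar> < 4 * \<alpha>"
      using a by linarith
    \<comment> \<open>Scaling turns the left ends into the integers \<open>spread (col j)\<close>.
      The two sides then differ by less than 1, so they are equal.\<close>
    then have "8 * (real R)\<^sup>2 * \<bar>p (J 0) + 3 * p (J 2) - (p (J 3) + 3 * p (J 1))\<bar> < 8 * (real R)\<^sup>2 * (4 * \<alpha>)"
      using \<open>0 < R\<close> by (intro mult_strict_left_mono) auto
    also have "\<dots> \<le> 1" using \<alpha>R by simp
    also have "8 * (real R)\<^sup>2 * \<bar>p (J 0) + 3 * p (J 2) - (p (J 3) + 3 * p (J 1))\<bar>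
      = \<bar>8 * (real R)\<^sup>2 * (p (J 0) + 3 * p (J 2) - (p (J 3) + 3 * p (J 1)))\<bar>"
      by (simp add: abs_mult)
    also have "8 * (real R)\<^sup>2 * (p (J 0) + 3 * p (J 2) - (p (J 3) + 3 * p (J 1)))
      = real (spread (col (J 0))) + 3 * real (spread (col (J 2)))
        - (real (spread (col (J 3))) + 3 * real (spread (col (J 1))))"
    proof -
      have scale: "8 * (real R)\<^sup>2 * p j = real (spread (col j))" for j
        using \<open>0 < R\<close> by (simp add: p_def)
      have "m * (a + 3 * b - (a' + 3 * b')) = m * a + 3 * (m * b) - (m * a' + 3 * (m * b'))"
        for m a b a' b' :: real by (simp add: algebra_simps)
      then show ?thesis by (simp only: scale)
    qed
    finally have "spread (col (J 0)) + 3 * spread (col (J 2)) = spread (col (J 3)) + 3 * spread (col (J 1))"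
      by linarith
    then have sym: "col (J 0) = col (J 3)" "col (J 1) = col (J 2)"
      using spread_unique by metis+
    have "real L * t < 1 \<or> 3 * N - 1 \<le> real L * t"
      using block_coloring_symmetric[OF c \<open>0 < N\<close> _ _ J_def col_def sym] t \<open>0 < L\<close>
      by (simp add: L_def)
    then have "t < 1 / L \<or> 1 - 1 / L \<le> t"
      using \<open>0 < L\<close> \<open>0 < N\<close> by (auto simp: L_def field_simps of_nat_diff)
    then show ?thesis
      using t by (auto simp: D_def t_def)
  qed
  then have "rho4 \<alpha> \<le> measure circle_measure D * \<alpha> ^ 3"
    using p D_borel \<open>0 < L\<close> \<open>0 < \<alpha>\<close> by (intro rho4_le_strip_set[of L \<alpha> p D]) force+
  also have "measure circle_measure D \<le> 2 / (3 * real N)"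
  proof -
    have L1: "1 / real L \<le> 1" using \<open>0 < L\<close> by simp
    have "measure circle_measure D \<le> measure circle_measure {d. 0 \<le> circle_rep d \<and> circle_rep d < 1 / L} +
        measure circle_measure {d. 1 - 1 / L \<le> circle_rep d \<and> circle_rep d < 1}"
      unfolding D_def using D_meas by (intro measure_Un_le) auto
    also have "\<dots> = 1 / L + 1 / L"
      using emeasure_circle_arc[of 0 "1 / L"] emeasure_circle_arc[of "1 - 1 / L" 1] L1
      by (simp add: measure_def)
    finally show ?thesis by (simp add: L_def)
  qed
  finally show ?thesis
    using \<open>0 < \<alpha>\<close> by (simp add: mult_right_mono)
qed

section \<open>Choice of the number of digits for a given \<alpha>\<close>

theorem theorem2p7:
  fixes r N :: nat
  assumes "r \<ge> 2" and "N \<ge> 1"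
    and "\<exists>c. coloring_without_symmetric_4AP r N c"
  shows "\<exists>C::real. \<forall>\<alpha>::real. 0 < \<alpha> \<and> \<alpha> < 1 \<longrightarrow>
           rho4 \<alpha> \<le> C * \<alpha> powr (3 + 1 / 2 * log (real r) (real N))"
proof -
  define l where "l = 1 / 2 * log (real r) (real N)"
  have l0: "0 \<le> l" using assms(1,2) by (simp add: l_def)
  \<comment> \<open>The exponent \<open>l\<close> converts the number \<open>r ^ (2 * k)\<close>, of
    order \<open>1 / \<alpha>\<close>, into the gain \<open>N ^ k\<close> in the measure of the
    differences.\<close>
  have power: "((real r) ^ (2 * k)) powr l = real N ^ k" for k
  proof -
    have "((real r) ^ (2 * k)) powr l = real r powr (log (real r) (real N) * real k)"
      using assms(1) by (simp add: powr_powr l_def ac_simps flip: powr_realpow)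
    also have "\<dots> = (real r powr log (real r) (real N)) powr real k"
      by (simp add: powr_powr)
    also have "\<dots> = real N ^ k"
      using assms(1,2) by (simp add: powr_realpow)
    finally show ?thesis .
  qed
  \<comment> \<open>The factor \<open>N\<close> pays for using one digit less than \<open>k\<close>,
    and \<open>288 powr l\<close> for the smallness condition in
    \<open>rho4_le_of_coloring\<close>.\<close>
  have "rho4 \<alpha> \<le> (N * 288 powr l) * \<alpha> powr (3 + l)" if \<alpha>: "0 < \<alpha>" "\<alpha> < 1" for \<alpha>
  proof -
    \<comment> \<open>The least such \<open>k\<close> is the first power of the coloring with too
      many colors for \<alpha>; the power \<open>k - 1\<close>, if there is one, still fits.\<close>
    have "\<exists>k. 1 < 288 * \<alpha> * (real r) ^ (2 * k)"
    proof -
      have "1 < (real r)\<^sup>2" using assms(1) by (simp add: one_less_power)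
      then obtain k where "1 / (288 * \<alpha>) < ((real r)\<^sup>2) ^ k"
        using real_arch_pow by blast
      then have "1 < 288 * \<alpha> * ((real r)\<^sup>2) ^ k"
        using \<alpha> by (simp add: field_simps)
      then show ?thesis by (auto simp only: power_mult)
    qed
    then obtain k where k: "1 < 288 * \<alpha> * (real r) ^ (2 * k)"
        and least: "\<And>i. i < k \<Longrightarrow> 288 * \<alpha> * (real r) ^ (2 * i) \<le> 1"
      using exists_least_iff[of "\<lambda>k. 1 < 288 * \<alpha> * (real r) ^ (2 * k)"] by (meson not_less)
    have "rho4 \<alpha> \<le> N * (1 / real N ^ k) * \<alpha> ^ 3"
    proof (cases k)
      case 0
      have "\<alpha> ^ 3 \<le> N * \<alpha> ^ 3" using assms(2) \<alpha> by simp
      then show ?thesis using rho4_le_cube[OF \<alpha>] 0 by simp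
    next
      case (Suc i)
      obtain c where "coloring_without_symmetric_4AP (r ^ i) (N ^ i) c"
        using assms(3) coloring_without_symmetric_4AP_power by blast
      then have "rho4 \<alpha> \<le> 2 / (3 * real (N ^ i)) * \<alpha> ^ 3"
        by (rule rho4_le_of_coloring) (use assms(2) \<alpha> least[of i] Suc in \<open>simp_all add: power_mult power_mult_distrib ac_simps flip: power_mult\<close>)
      also have "\<dots> \<le> 1 / real N ^ i * \<alpha> ^ 3"
        using assms(2) \<alpha> by (intro mult_right_mono) (simp_all add: field_simps)
      also have "1 / real N ^ i = N * (1 / real N ^ k)"
        using assms(2) Suc by simp
      finally show ?thesis .
    qed
    also have "\<dots> \<le> N * (288 * \<alpha>) powr l * \<alpha> ^ 3"
    proof -
      \<comment> \<open>The failure of the smallness condition at \<open>k\<close> is what bounds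
        \<open>1 / N ^ k\<close> by a power of \<alpha>.\<close>
      have "1 \<le> (288 * \<alpha> * (real r) ^ (2 * k)) powr l"
        using k l0 by (intro ge_one_powr_ge_zero) auto
      also have "\<dots> = (288 * \<alpha>) powr l * real N ^ k"
        using \<alpha> by (simp add: powr_mult power)
      finally have "1 / real N ^ k \<le> (288 * \<alpha>) powr l"
        using assms(2) by (simp add: field_simps)
      then show ?thesis
        using \<alpha> by (intro mult_right_mono mult_left_mono) auto
    qed
    also have "\<dots> = (N * 288 powr l) * \<alpha> powr (3 + l)"
      using \<alpha> by (simp add: powr_mult powr_add)
    finally show ?thesis .
  qed
  then show ?thesis unfolding l_def by blast
qed

end
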